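(* Let $X=(X_u,u\in\mathbb{T})$ be a bifurcating Markov chain on $(S,\mathscr{S})$ with initial distribution $\nu$ and probability kernel $\mathcal{P}$, let $\mathcal{Q}$ be the induced kernel, let $F\subset\mathcal{B}(S)$ satisfy the structural assumption, and suppose the geometric ergodicity assumption holds with probability measure $\mu$ and an arbitrary rate $\alpha\in(0,1)$. Let $\mathfrak{f}=(f_\ell,\ell\in\mathbb{N})$ be a sequence of elements of $\mathcal{B}(S^3)$ such that for all $\ell\in\mathbb{N}$, $\mathcal{P}f_\ell$, $\mathcal{P}(f_\ell^2)$ and $\mathcal{P}(f_\ell^4)$ are well defined, and such that $(\mathcal{P}f_\ell)_{\ell\in\mathbb{N}}$, $(\mathcal{P}(f_\ell^2))_{\ell\in\mathbb{N}}$ and $(\mathcal{P}(f_\ell^4))_{\ell\in\mathbb{N}}$ are sequences of elements of $F$ which satisfy the uniform ergodic bounds for some $g\in F$. Assume moreover that $\mathcal{P}f_\ell=0$ for all $\ell\in\mathbb{N}$. Then $$N_{n,\emptyset}(\mathfrak{f})\xrightarrow[n\to\infty]{(d)}G,$$ where $G$ is a centered Gaussian real-valued random variable with variance $$\Sigma(\mathfrak{f})=\sum_{\ell=0}^{\infty}2^{-\ell}\langle\mu,\mathcal{P}(f_\ell^2)\rangle.$$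
   Context: **Function spaces and kernels.** $(S,\mathscr{S})$ is a measurable space; $\mathcal{B}(E)$ (resp. $\mathcal{B}_b(E)$) is the set of real-valued (resp. bounded real-valued) measurable functions on a measurable space $E$; $\langle\lambda,f\rangle=\int f\,d\lambda$. For a probability kernel $Q$ on $S\times\mathscr{S}$, $(Qf)(x)=\int f(y)Q(x,dy)$; $Q^n$ is its $n$-th iterate, $Q^0$ the identity. For a probability kernel $\mathcal{P}$ on $S\times\mathscr{S}^{\otimes2}$, $f\in\mathcal{B}(S^3)$ and $h\in\mathcal{B}(S^2)$: $(\mathcal{P}f)(x)=\int f(x,y,z)\mathcal{P}(x,dy,dz)$, $(\mathcal{P}h)(x)=\int h(y,z)\mathcal{P}(x,dy,dz)$, whenever the integrals are well defined. **Tree.** $\mathbb{G}_0=\{\emptyset\}$, $\mathbb{G}_k=\{0,1\}^k$, $\mathbb{T}_k=\bigcup_{0\le r\le k}\mathbb{G}_r$, $\mathbb{T}=\bigcup_{r\ge 0}\mathbb{G}_r$; $u0,u1$ denote concatenation of $u\in\mathbb{T}$ with $0$, $1$; $|\mathbb{G}_n|=2^n$. **Bifurcating Markov chain (BMC).** $X=(X_u,u\in\mathbb{T})$ with values in $S$ is a BMC with initial distribution $\nu$ and kernel $\mathcal{P}$ (a probability kernel on $S\times\mathscr{S}^{\otimes 2}$) if $X_\emptyset$ has law $\nu$ and, for all families $(g_u)_{u\in\mathbb{T}}$ in $\mathcal{B}_b(S^3)$ and all $k\ge0$, $\mathbb{E}[\prod_{u\in\mathbb{G}_k}g_u(X_u,X_{u0},X_{u1})\mid\sigma(X_j;j\in\mathbb{T}_k)]=\prod_{u\in\mathbb{G}_k}\mathcal{P}g_u(X_u)$.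 The induced kernel is $\mathcal{Q}=\frac12(P_0+P_1)$ with $P_0(x,A)=\mathcal{P}(x,A\times S)$, $P_1(x,A)=\mathcal{P}(x,S\times A)$. Write $X_u^{\triangle}=(X_u,X_{u0},X_{u1})$. **Structural assumption on $F\subset\mathcal{B}(S)$.** Here $(f_0\otimes f_1)(x,y)=f_0(x)f_1(y)$. (i) $F$ is a vector subspace containing the constants; (ii) $f^2\in F$ for all $f\in F$; (iii) $F\subset L^1(\nu)$; (iv) for all $f_0,f_1\in F$, $f_0\otimes f_1\in L^1(\mathcal{P}(x,\cdot))$ for all $x\in S$, and $\mathcal{P}(f_0\otimes f_1)\in F$. **Geometric ergodicity assumption.** There are a probability measure $\mu$ on $(S,\mathscr{S})$ with $F\subset L^1(\mu)$ and $\alpha\in(0,1)$ such that for all $f\in F$ there is $g\in F$ with $|\mathcal{Q}^nf-\langle\mu,f\rangle|\le\alpha^ng$ for all $n\in\mathbb{N}$. **Uniform ergodic bounds.** A sequence $(h_\ell)_{\ell\in\mathbb{N}}$ in $F$ satisfies the uniform ergodic bounds for $g\in F$ if $|\mathcal{Q}^n(h_\ell)|\le g$ and $|\mathcal{Q}^nh_\ell-\langle\mu,h_\ell\rangle|\le\alpha^ng$ for all $n,\ell\in\mathbb{N}$. **Notation.** For $f\in\mathcal{B}(S^3)$ and finite $A\subset\mathbb{T}$, $M_A(f)=\sum_{u\in A}f(X_u^\triangle)$. For $f\in\mathcal{B}(S^3)$, $\tilde f=f-\langle\mu,\mathcal{P}f\rangle$ (so $\tilde f=f$ when $\mathcal{P}f=0$).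 Finally $N_{n,\emptyset}(\mathfrak{f})=|\mathbb{G}_n|^{-1/2}\sum_{\ell=0}^nM_{\mathbb{G}_{n-\ell}}(\tilde f_\ell)$. A Gaussian random variable of variance $0$ is understood as a constant; $(d)$ denotes convergence in distribution. *)

theory Defs
  imports "HOL-Probability.Probability"
begin

(* The state space is the measurable space underlying S :: 's measure, with carrier
   "space S"; only "space S" and "sets S" are ever used.  A probability kernel from S to
   the product of S with itself is P :: 's => ('s * 's) measure with
   P : S ->M prob_algebra (S (x) S).  A real-valued function on S is a HOL function on 's
   of which only the values on "space S" matter; pointwise conditions are therefore
   restricted to "space S", and a set F of functions on S is represented by any set of
   HOL functions on 's, e.g. by all extensions of its elements. *)

definition kernel_op :: "('a \<Rightarrow> 'b measure) \<Rightarrow> ('b \<Rightarrow> real) \<Rightarrow> 'a \<Rightarrow> real" where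
  "kernel_op K f x = (\<integral>y. f y \<partial>K x)"

definition kernel_op3 ::
    "('s \<Rightarrow> ('s \<times> 's) measure) \<Rightarrow> ('s \<times> 's \<times> 's \<Rightarrow> real) \<Rightarrow> 's \<Rightarrow> real" where
  "kernel_op3 P f x = (\<integral>(y, z). f (x, y, z) \<partial>P x)"

(* The Bochner integral is 0 for non-integrable functions, so that integrability
   has to be required separately. *)
definition well_defined3 ::
    "'s measure \<Rightarrow> ('s \<Rightarrow> ('s \<times> 's) measure) \<Rightarrow> ('s \<times> 's \<times> 's \<Rightarrow> real) \<Rightarrow> bool" where
  "well_defined3 S P f \<longleftrightarrow> (\<forall>x\<in>space S. integrable (P x) (\<lambda>(y, z). f (x, y, z)))"

(* (P0 + P1) / 2, where P0 and P1 are the two marginals of P. *)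
definition induced_kernel ::
    "'s measure \<Rightarrow> ('s \<Rightarrow> ('s \<times> 's) measure) \<Rightarrow> 's \<Rightarrow> 's measure" where
  "induced_kernel S P x = measure_of (space S) (sets S)
     (\<lambda>A. (emeasure (P x) (A \<times> space S) + emeasure (P x) (space S \<times> A)) / 2)"

(* For f in F no integrability side condition is needed where integrals against
   "kernel_pow S (induced_kernel S P) n x" occur below: the structural assumption gives
   f^2 in F and hence, by Tonelli, the finiteness of the integrals of f^2. *)
primrec kernel_pow :: "'s measure \<Rightarrow> ('s \<Rightarrow> 's measure) \<Rightarrow> nat \<Rightarrow> 's \<Rightarrow> 's measure" where
  "kernel_pow S Q 0 = return S"
| "kernel_pow S Q (Suc n) = (\<lambda>x. kernel_pow S Q n x \<bind> Q)"

(* The vertices of the infinite binary tree are the finite words over {0,1}, represented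
   as boolean lists with 0 = False and 1 = True. *)
type_synonym vertex = "bool list"

definition generation :: "nat \<Rightarrow> vertex set" where
  "generation k = {u. length u = k}"

definition tree_upto :: "nat \<Rightarrow> vertex set" where
  "tree_upto k = (\<Union>r\<in>{..k}. generation r)"

definition triangle :: "(vertex \<Rightarrow> 'w \<Rightarrow> 's) \<Rightarrow> vertex \<Rightarrow> 'w \<Rightarrow> 's \<times> 's \<times> 's" where
  "triangle X u \<omega> = (X u \<omega>, X (u @ [False]) \<omega>, X (u @ [True]) \<omega>)"

definition history ::
    "'w measure \<Rightarrow> 's measure \<Rightarrow> (vertex \<Rightarrow> 'w \<Rightarrow> 's) \<Rightarrow> nat \<Rightarrow> 'w measure" where
  "history \<Omega> S X k =
     sigma (space \<Omega>) {X j -` A \<inter> space \<Omega> | j A. j \<in> tree_upto k \<and> A \<in> sets S}"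

definition bifurcating_markov_chain ::
    "'w measure \<Rightarrow> 's measure \<Rightarrow> 's measure \<Rightarrow> ('s \<Rightarrow> ('s \<times> 's) measure)
      \<Rightarrow> (vertex \<Rightarrow> 'w \<Rightarrow> 's) \<Rightarrow> bool" where
  "bifurcating_markov_chain \<Omega> S \<nu> P X \<longleftrightarrow>
     prob_space \<Omega> \<and>
     (\<forall>u. X u \<in> \<Omega> \<rightarrow>\<^sub>M S) \<and>
     distr \<Omega> S (X []) = \<nu> \<and>
     (\<forall>g k. (\<forall>u. g u \<in> borel_measurable (S \<Otimes>\<^sub>M S \<Otimes>\<^sub>M S) \<and>
                 (\<exists>C. \<forall>t\<in>space (S \<Otimes>\<^sub>M S \<Otimes>\<^sub>M S). \<bar>g u t\<bar> \<le> C)) \<longrightarrow>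
        (AE \<omega> in \<Omega>.
           real_cond_exp \<Omega> (history \<Omega> S X k)
             (\<lambda>\<omega>'. \<Prod>u\<in>generation k. g u (triangle X u \<omega>')) \<omega>
           = (\<Prod>u\<in>generation k. kernel_op3 P (g u) (X u \<omega>))))"

definition structural_assumption ::
    "'s measure \<Rightarrow> 's measure \<Rightarrow> ('s \<Rightarrow> ('s \<times> 's) measure) \<Rightarrow> ('s \<Rightarrow> real) set \<Rightarrow> bool" where
  "structural_assumption S \<nu> P F \<longleftrightarrow>
     F \<subseteq> borel_measurable S \<and>
     (\<forall>f\<in>F. \<forall>h\<in>F. (\<lambda>x. f x + h x) \<in> F) \<and>
     (\<forall>f\<in>F. \<forall>c. (\<lambda>x. c * f x) \<in> F) \<and>
     (\<forall>c. (\<lambda>_. c) \<in> F) \<and>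
     (\<forall>f\<in>F. (\<lambda>x. (f x)\<^sup>2) \<in> F) \<and>
     (\<forall>f\<in>F. integrable \<nu> f) \<and>
     (\<forall>f\<^sub>0\<in>F. \<forall>f\<^sub>1\<in>F.
        (\<forall>x\<in>space S. integrable (P x) (\<lambda>(y, z). f\<^sub>0 y * f\<^sub>1 z)) \<and>
        kernel_op P (\<lambda>(y, z). f\<^sub>0 y * f\<^sub>1 z) \<in> F)"

definition geometric_ergodicity ::
    "'s measure \<Rightarrow> ('s \<Rightarrow> 's measure) \<Rightarrow> ('s \<Rightarrow> real) set \<Rightarrow> 's measure \<Rightarrow> real \<Rightarrow> bool" where
  "geometric_ergodicity S Q F \<mu> \<alpha> \<longleftrightarrow>
     \<mu> \<in> space (prob_algebra S) \<and>
     (\<forall>f\<in>F. integrable \<mu> f) \<and>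
     0 < \<alpha> \<and> \<alpha> < 1 \<and>
     (\<forall>f\<in>F. \<exists>g\<in>F. \<forall>n. \<forall>x\<in>space S.
        \<bar>kernel_op (kernel_pow S Q n) f x - (\<integral>y. f y \<partial>\<mu>)\<bar> \<le> \<alpha> ^ n * g x)"

definition uniform_ergodic_bounds ::
    "'s measure \<Rightarrow> ('s \<Rightarrow> 's measure) \<Rightarrow> ('s \<Rightarrow> real) set \<Rightarrow> 's measure \<Rightarrow> real
      \<Rightarrow> (nat \<Rightarrow> 's \<Rightarrow> real) \<Rightarrow> ('s \<Rightarrow> real) \<Rightarrow> bool" where
  "uniform_ergodic_bounds S Q F \<mu> \<alpha> h g \<longleftrightarrow>
     (\<forall>l. h l \<in> F) \<and>
     (\<forall>n l. \<forall>x\<in>space S.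
        \<bar>kernel_op (kernel_pow S Q n) (h l) x\<bar> \<le> g x \<and>
        \<bar>kernel_op (kernel_pow S Q n) (h l) x - (\<integral>y. h l y \<partial>\<mu>)\<bar> \<le> \<alpha> ^ n * g x)"

definition tree_sum ::
    "(vertex \<Rightarrow> 'w \<Rightarrow> 's) \<Rightarrow> vertex set \<Rightarrow> ('s \<times> 's \<times> 's \<Rightarrow> real) \<Rightarrow> 'w \<Rightarrow> real" where
  "tree_sum X A f \<omega> = (\<Sum>u\<in>A. f (triangle X u \<omega>))"

definition centred ::
    "('s \<Rightarrow> ('s \<times> 's) measure) \<Rightarrow> 's measure \<Rightarrow> ('s \<times> 's \<times> 's \<Rightarrow> real)
      \<Rightarrow> 's \<times> 's \<times> 's \<Rightarrow> real" where
  "centred P \<mu> f t = f t - (\<integral>x. kernel_op3 P f x \<partial>\<mu>)"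

definition N_root ::
    "('s \<Rightarrow> ('s \<times> 's) measure) \<Rightarrow> 's measure \<Rightarrow> (vertex \<Rightarrow> 'w \<Rightarrow> 's)
      \<Rightarrow> (nat \<Rightarrow> 's \<times> 's \<times> 's \<Rightarrow> real) \<Rightarrow> nat \<Rightarrow> 'w \<Rightarrow> real" where
  "N_root P \<mu> X f n \<omega> =
     (\<Sum>l\<le>n. tree_sum X (generation (n - l)) (centred P \<mu> (f l)) \<omega>)
       / sqrt (real (card (generation n)))"

(* The normal law with mean m and variance v >= 0, a point mass if v = 0. *)
definition gaussian_law :: "real \<Rightarrow> real \<Rightarrow> real measure" where
  "gaussian_law m v =
     (if v = 0 then return borel m else density lborel (normal_density m (sqrt v)))"

end

theory Submission
  imports Defs
begin

text \<open>
  Because \<open>P f\<^sub>\<ell> = 0\<close>, the contributions of the successive generations are martingale increments,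
  and given the past the triangles of one generation are independent.  Writing \<open>s = t / 2\<^sup>n\<^sup>/\<^sup>2\<close>,
  \<open>h\<^sub>\<ell> = P (f\<^sub>\<ell>\<^sup>2)\<close> and \<open>\<sigma>\<^sub>\<ell>\<close> for the \<open>\<mu>\<close>-mean of \<open>h\<^sub>\<ell>\<close>, a third order expansion shows that
  integrating out generation \<open>k\<close> multiplies the characteristic function by
  \<open>exp (- s\<^sup>2 / 2 \<Sum>\<^sub>u h\<^sub>n\<^sub>-\<^sub>k (X\<^sub>u))\<close> up to a negligible error.  This random factor can be replaced by the
  constant \<open>exp (- s\<^sup>2 2\<^sup>k \<sigma>\<^sub>n\<^sub>-\<^sub>k / 2)\<close> by a law of large numbers in \<open>L\<^sup>2\<close>: if \<open>M\<^sub>k h\<close> is the sum of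
  \<open>h (X\<^sub>u)\<close> over generation \<open>k\<close>, conditioning on the past gives
  \<open>E (M\<^sub>k\<^sub>+\<^sub>1 h)\<^sup>2 \<le> 4 E (M\<^sub>k (Q h))\<^sup>2 + 4 E (M\<^sub>k (Q h\<^sup>2))\<close>, so that geometric ergodicity, whatever its rate,
  makes \<open>4\<^sup>-\<^sup>k E (M\<^sub>k h)\<^sup>2\<close> decay geometrically for centred \<open>h\<close>.  As \<open>\<Sum>\<^sub>k s\<^sup>2 2\<^sup>k \<sigma>\<^sub>n\<^sub>-\<^sub>k = t\<^sup>2 \<Sum>\<^sub>l 2\<^sup>-\<^sup>l \<sigma>\<^sub>l\<close>,
  Levy's theorem concludes.
\<close>

section \<open>Generations of the binary tree\<close>

lemma finite_generation [simp, intro]: "finite (generation k)"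
  and card_generation: "card (generation k) = 2 ^ k"
proof -
  have "generation k = {xs. set xs \<subseteq> (UNIV :: bool set) \<and> length xs = k}"
    by (auto simp: generation_def)
  then show "finite (generation k)" "card (generation k) = 2 ^ k"
    using finite_lists_length_eq[of "UNIV :: bool set" k] card_lists_length_eq[of "UNIV :: bool set" k]
    by (simp_all add: card_UNIV_bool)
qed

lemma generation_0: "generation 0 = {[]}"
  by (auto simp: generation_def)

text \<open>Children append a letter at the end of a word, so the words of length k + 1 are split by
  their last letter and each vertex of generation k contributes its two children.\<close>

lemma sum_generation_Suc:
  fixes g :: "vertex \<Rightarrow> 'a::comm_monoid_add"
  shows "(\<Sum>u\<in>generation (Suc k). g u) = (\<Sum>u\<in>generation k. g (u @ [False]) + g (u @ [True]))"
proof -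
  have eq: "generation (Suc k) =
      (\<lambda>u. u @ [False]) ` generation k \<union> (\<lambda>u. u @ [True]) ` generation k" (is "_ = ?A \<union> ?B")
  proof (intro equalityI subsetI)
    fix w assume "w \<in> generation (Suc k)"
    then obtain u b where "w = u @ [b]" "u \<in> generation k"
      by (auto simp: generation_def length_Suc_conv_rev)
    then show "w \<in> ?A \<union> ?B" by (cases b) auto
  qed (auto simp: generation_def)
  have "sum g (?A \<union> ?B) = sum g ?A + sum g ?B"
    by (rule sum.union_disjoint) auto
  then show ?thesis
    by (simp add: eq sum.reindex inj_on_def sum.distrib)
qed

section \<open>The induced kernel\<close>

text \<open>On the state space this is \<open>Q h\<close>.  It replaces \<^const>\<open>kernel_op\<close> of the induced kernel because
  membership in \<open>F\<close> also depends on the values off the state space, where the latter is junk.\<close>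
definition mean_child :: "('s \<Rightarrow> ('s \<times> 's) measure) \<Rightarrow> ('s \<Rightarrow> real) \<Rightarrow> 's \<Rightarrow> real" where
  "mean_child P h x = ((\<integral>p. h (fst p) \<partial>P x) + (\<integral>p. h (snd p) \<partial>P x)) / 2"

section \<open>Standing assumptions and closure properties of \<open>F\<close>\<close>

locale markov_tree =
  fixes \<Omega> :: "'w measure" and S :: "'s measure" and \<nu> \<mu> :: "'s measure"
    and P :: "'s \<Rightarrow> ('s \<times> 's) measure"
    and X :: "vertex \<Rightarrow> 'w \<Rightarrow> 's"
    and F :: "('s \<Rightarrow> real) set" and \<alpha> :: real
  assumes \<nu>: "\<nu> \<in> space (prob_algebra S)"
    and P: "P \<in> S \<rightarrow>\<^sub>M prob_algebra (S \<Otimes>\<^sub>M S)"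
    and bmc: "bifurcating_markov_chain \<Omega> S \<nu> P X"
    and structural: "structural_assumption S \<nu> P F"
    and ergodic: "geometric_ergodicity S (induced_kernel S P) F \<mu> \<alpha>"
begin

lemmas P_sub [measurable] = measurable_prob_algebraD[OF P]

lemma prob_P: "x \<in> space S \<Longrightarrow> prob_space (P x)"
  using measurable_space[OF P] by (simp add: space_prob_algebra)

lemma sets_P: "x \<in> space S \<Longrightarrow> sets (P x) = sets (S \<Otimes>\<^sub>M S)"
  using measurable_space[OF P] by (simp add: space_prob_algebra)

lemma space_P: "x \<in> space S \<Longrightarrow> space (P x) = space S \<times> space S"
  using sets_eq_imp_space_eq[OF sets_P] by (simp add: space_pair_measure)

lemma meas_P: "x \<in> space S \<Longrightarrow> measurable (P x) N = measurable (S \<Otimes>\<^sub>M S) N"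
  by (intro measurable_cong_sets sets_P) auto

lemma F_meas: "h \<in> F \<Longrightarrow> h \<in> borel_measurable S"
  and F_add: "h \<in> F \<Longrightarrow> h' \<in> F \<Longrightarrow> (\<lambda>x. h x + h' x) \<in> F"
  and F_scale: "h \<in> F \<Longrightarrow> (\<lambda>x. c * h x) \<in> F"
  and F_const: "(\<lambda>_. c) \<in> F"
  and F_power2: "h \<in> F \<Longrightarrow> (\<lambda>x. (h x)\<^sup>2) \<in> F"
  and F_integrable_\<nu>: "h \<in> F \<Longrightarrow> integrable \<nu> h"
  using structural unfolding structural_assumption_def by auto

lemma F_diff: "h \<in> F \<Longrightarrow> h' \<in> F \<Longrightarrow> (\<lambda>x. h x - h' x) \<in> F"
  using F_add[of h "\<lambda>x. - 1 * h' x"] F_scale[of h' "- 1"] by simp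

lemma F_prod_kernel:
  assumes "h \<in> F" "h' \<in> F"
  shows "x \<in> space S \<Longrightarrow> integrable (P x) (\<lambda>(y, z). h y * h' z)"
    and "kernel_op P (\<lambda>(y, z). h y * h' z) \<in> F"
  using structural assms unfolding structural_assumption_def by blast+

text \<open>The structural assumption speaks of tensor products only. With the constant 1, an
  element of \<open>F\<close>, as one of the two factors it covers each child separately.\<close>

lemma F_children_integrable:
  assumes "h \<in> F" "x \<in> space S"
  shows "integrable (P x) (\<lambda>p. h (fst p))" "integrable (P x) (\<lambda>p. h (snd p))"
  using F_prod_kernel(1)[OF assms(1) F_const[of 1] assms(2)]
    F_prod_kernel(1)[OF F_const[of 1] assms(1) assms(2)]
  by (simp_all add: case_prod_unfold)

lemma F_children:
  assumes "h \<in> F"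
  shows "(\<lambda>x. \<integral>p. h (fst p) \<partial>P x) \<in> F" "(\<lambda>x. \<integral>p. h (snd p) \<partial>P x) \<in> F"
  using F_prod_kernel(2)[OF assms F_const[of 1]] F_prod_kernel(2)[OF F_const[of 1] assms]
  by (simp_all add: case_prod_unfold kernel_op_def[abs_def])

lemma mean_child_F: "h \<in> F \<Longrightarrow> mean_child P h \<in> F"
  using F_scale[OF F_add[OF F_children(1) F_children(2)], of h h "1 / 2"]
  by (simp add: mean_child_def[abs_def])

lemma mean_child_pow_F: "h \<in> F \<Longrightarrow> (mean_child P ^^ n) h \<in> F"
  by (induction n) (auto intro: mean_child_F)

lemma mean_child_linear:
  assumes "h \<in> F" "h' \<in> F" "x \<in> space S"
  shows "mean_child P (\<lambda>y. (h y - h' y) / c) x = (mean_child P h x - mean_child P h' x) / c"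
  using F_children_integrable[OF assms(1,3)] F_children_integrable[OF assms(2,3)]
  by (simp add: mean_child_def diff_divide_distrib add_divide_distrib)

text \<open>Reduces identities between linear functionals on F to non-negative functions.\<close>
lemma F_polarization:
  assumes "h \<in> F"
  obtains a b where "a \<in> F" "b \<in> F" "\<And>x. 0 \<le> a x" "\<And>x. 0 \<le> b x"
    "h = (\<lambda>x. (a x - b x) / 4)"
proof
  \<comment> \<open>Squares lie in \<open>F\<close> by assumption, whereas the positive and negative
    parts of \<open>h\<close> need not.\<close>
  show "(\<lambda>x. (h x + 1)\<^sup>2) \<in> F" "(\<lambda>x. (h x - 1)\<^sup>2) \<in> F"
    using assms by (auto intro!: F_power2 F_add F_diff F_const)
  show "h = (\<lambda>x. ((h x + 1)\<^sup>2 - (h x - 1)\<^sup>2) / 4)"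
    by (rule ext) (simp add: power2_eq_square algebra_simps)
qed auto

text \<open>A fair coin chooses the child, and given the coin the law is a marginal of
  \<open>P x\<close>. In this form measurability in x and the integral formula follow from the
  general rules for \<open>bind\<close>, which the explicit \<open>measure_of\<close> does not
  offer.\<close>

lemma induced_kernel_eq_bind:
  assumes x: "x \<in> space S"
  shows "induced_kernel S P x =
    measure_pmf (bernoulli_pmf (1 / 2)) \<bind> (\<lambda>b. distr (P x) S (if b then fst else snd))" (is "_ = ?B")
proof -
  interpret prob_space "P x" using prob_P[OF x] .
  have N: "(\<lambda>b. distr (P x) S (if b then fst else snd))
      \<in> measure_pmf (bernoulli_pmf (1 / 2)) \<rightarrow>\<^sub>M subprob_algebra S"
    by (auto simp: space_subprob_algebra meas_P[OF x] intro!: prob_space_imp_subprob_space prob_space_distr)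
  have sets: "sets ?B = sets S"
    by (rule sets_bind) auto
  have space: "space ?B = space S" using sets by (rule sets_eq_imp_space_eq)
  have "emeasure ?B A = (emeasure (P x) (A \<times> space S) + emeasure (P x) (space S \<times> A)) / 2"
    if A: "A \<in> sets S" for A
  proof -
    have 1: "fst -` A \<inter> space (P x) = A \<times> space S" "snd -` A \<inter> space (P x) = space S \<times> A"
      using sets.sets_into_space[OF A] by (auto simp: space_P[OF x])
    have "emeasure ?B A = (\<integral>\<^sup>+b. emeasure (distr (P x) S (if b then fst else snd)) A
        \<partial>measure_pmf (bernoulli_pmf (1 / 2)))"
      by (rule emeasure_bind[OF _ N A]) auto
    also have "\<dots> = emeasure (P x) (A \<times> space S) * ennreal (1 / 2) + emeasure (P x) (space S \<times> A) * ennreal (1 / 2)"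
      by (simp add: emeasure_distr A meas_P[OF x] 1)
    also have "\<dots> = (emeasure (P x) (A \<times> space S) + emeasure (P x) (space S \<times> A)) / 2"
      by (simp add: divide_ennreal_def distrib_right)
    finally show ?thesis .
  qed
  \<comment> \<open>\<open>measure_of\<close> depends on the set function only through its values on
    the sigma-algebra, so the formula just proved identifies the two measures.\<close>
  then have "induced_kernel S P x = measure_of (space ?B) (sets ?B) (emeasure ?B)"
    unfolding induced_kernel_def sets space
    by (intro measure_of_eq sets.space_closed) (simp add: sets.sigma_sets_eq)
  then show ?thesis using measure_of_of_measure[of ?B] by simp
qed

lemma nn_integral_induced_kernel:
  assumes x: "x \<in> space S" and h: "h \<in> borel_measurable S"
  shows "(\<integral>\<^sup>+y. h y \<partial>induced_kernel S P x) =
    (\<integral>\<^sup>+p. h (fst p) \<partial>P x) * ennreal (1 / 2) + (\<integral>\<^sup>+p. h (snd p) \<partial>P x) * ennreal (1 / 2)"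
proof -
  interpret prob_space "P x" using prob_P[OF x] .
  have N: "(\<lambda>b. distr (P x) S (if b then fst else snd))
      \<in> measure_pmf (bernoulli_pmf (1 / 2)) \<rightarrow>\<^sub>M subprob_algebra S"
    by (auto simp: space_subprob_algebra meas_P[OF x] intro!: prob_space_imp_subprob_space prob_space_distr)
  show ?thesis
    unfolding induced_kernel_eq_bind[OF x] nn_integral_bind[OF h N]
    using h by (simp add: nn_integral_distr meas_P[OF x])
qed

lemma induced_kernel_measurable: "induced_kernel S P \<in> S \<rightarrow>\<^sub>M prob_algebra S"
proof -
  have "(\<lambda>x. measure_pmf (bernoulli_pmf (1 / 2)) \<bind> (\<lambda>b. distr (P x) S (if b then fst else snd)))
      \<in> S \<rightarrow>\<^sub>M prob_algebra S"
  proof (rule measurable_bind_prob_space2)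
    show "(\<lambda>x. measure_pmf (bernoulli_pmf (1 / 2))) \<in> S \<rightarrow>\<^sub>M prob_algebra (count_space UNIV)"
      by (auto intro!: measurable_const simp: space_prob_algebra measure_pmf.prob_space_axioms)
    have "(\<lambda>p. if snd p then distr (P (fst p)) S fst else distr (P (fst p)) S snd)
      \<in> S \<Otimes>\<^sub>M count_space UNIV \<rightarrow>\<^sub>M prob_algebra S"
      using P by measurable
    then show "(\<lambda>(x, b). distr (P x) S (if b then fst else snd)) \<in> S \<Otimes>\<^sub>M count_space UNIV \<rightarrow>\<^sub>M prob_algebra S"
      by (rule measurable_cong[THEN iffD1, rotated]) auto
  qed
  then show ?thesis
    by (rule measurable_cong[THEN iffD1, rotated]) (simp add: induced_kernel_eq_bind)
qed

lemma kernel_pow_measurable: "kernel_pow S (induced_kernel S P) n \<in> S \<rightarrow>\<^sub>M prob_algebra S"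
  by (induction n) (auto intro!: measurable_bind_prob_space induced_kernel_measurable)

lemma nn_integral_induced_F:
  assumes a: "a \<in> F" "\<And>y. 0 \<le> a y" and x: "x \<in> space S"
  shows "(\<integral>\<^sup>+y. ennreal (a y) \<partial>induced_kernel S P x) = ennreal (mean_child P a x)"
proof -
  note int = F_children_integrable[OF a(1) x]
  have "(\<integral>\<^sup>+y. ennreal (a y) \<partial>induced_kernel S P x) =
     ennreal (\<integral>p. a (fst p) \<partial>P x) * ennreal (1 / 2) + ennreal (\<integral>p. a (snd p) \<partial>P x) * ennreal (1 / 2)"
    using F_meas[OF a(1)]
    by (simp add: nn_integral_induced_kernel[OF x] nn_integral_eq_integral[OF int(1)]
        nn_integral_eq_integral[OF int(2)] a(2))
  also have "\<dots> = ennreal (mean_child P a x)"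
    by (subst (1 2) ennreal_mult''[symmetric])
      (simp_all add: mean_child_def a(2) add_divide_distrib flip: ennreal_plus)
  finally show ?thesis .
qed

lemma mean_child_nonneg: "(\<And>y. 0 \<le> a y) \<Longrightarrow> 0 \<le> mean_child P a x"
  by (simp add: mean_child_def integral_nonneg_AE)

text \<open>This identifies the iterates in the ergodicity assumption with iterates of
  \<open>mean_child\<close>, which stay in \<open>F\<close>. The induction on n runs over all h at
  once: powers are extended on the right, so the new factor acts on h first and the hypothesis is
  applied to \<open>mean_child P h\<close>.\<close>

lemma kernel_pow_F:
  assumes "h \<in> F" "x \<in> space S"
  shows "integrable (kernel_pow S (induced_kernel S P) n x) h \<and>
    kernel_op (kernel_pow S (induced_kernel S P) n) h x = (mean_child P ^^ n) h x"
  using assms(1)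
proof (induction n arbitrary: h)
  case 0
  then show ?case
    using assms(2) F_meas[OF 0]
    by (simp add: kernel_op_def integral_return integrable_iff_bounded nn_integral_return)
next
  case (Suc n)
  let ?K = "kernel_pow S (induced_kernel S P) n x"
  have K: "?K \<in> space (prob_algebra S)"
    using measurable_space[OF kernel_pow_measurable assms(2)] .
  then have sets_K: "sets ?K = sets S" by (simp add: space_prob_algebra)
  then have space_K: "space ?K = space S" by (rule sets_eq_imp_space_eq)
  have N: "induced_kernel S P \<in> ?K \<rightarrow>\<^sub>M subprob_algebra S"
    using measurable_prob_algebraD[OF induced_kernel_measurable] sets_K
    by (simp cong: measurable_cong_sets)
  \<comment> \<open>For nonnegative functions the integral against a composition is an iterated
    integral, and the induction hypothesis for \<open>mean_child P a\<close> makes it finite.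
    Polarization then reaches all of \<open>F\<close>.\<close>
  have nonneg: "has_bochner_integral (?K \<bind> induced_kernel S P) a
      (\<integral>y. mean_child P a y \<partial>?K)" if a: "a \<in> F" "\<And>y. 0 \<le> a y" for a
  proof (rule has_bochner_integral_nn_integral)
    have "sets (?K \<bind> induced_kernel S P) = sets S"
      using sets_bind'[OF K induced_kernel_measurable] .
    then show "a \<in> borel_measurable (?K \<bind> induced_kernel S P)"
      using F_meas[OF a(1)] by (simp cong: measurable_cong_sets)
    have "(\<integral>\<^sup>+y. ennreal (a y) \<partial>(?K \<bind> induced_kernel S P)) =
      (\<integral>\<^sup>+x. \<integral>\<^sup>+y. ennreal (a y) \<partial>induced_kernel S P x \<partial>?K)"
      using F_meas[OF a(1)] by (intro nn_integral_bind[OF _ N]) simp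
    also have "\<dots> = (\<integral>\<^sup>+x. ennreal (mean_child P a x) \<partial>?K)"
      by (intro nn_integral_cong nn_integral_induced_F a) (simp add: space_K)
    also have "\<dots> = ennreal (\<integral>x. mean_child P a x \<partial>?K)"
      using Suc.IH[OF mean_child_F[OF a(1)]] mean_child_nonneg[OF a(2)]
      by (intro nn_integral_eq_integral) auto
    finally show "(\<integral>\<^sup>+y. ennreal (a y) \<partial>(?K \<bind> induced_kernel S P)) = \<dots>" .
  qed (auto simp: a(2) intro!: integral_nonneg_AE mean_child_nonneg)
  obtain a b where ab: "a \<in> F" "b \<in> F" "\<And>x. 0 \<le> a x" "\<And>x. 0 \<le> b x"
    and h: "h = (\<lambda>x. (a x - b x) / 4)" using F_polarization[OF Suc.prems] by blast
  have "has_bochner_integral (?K \<bind> induced_kernel S P) h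
      (((\<integral>y. mean_child P a y \<partial>?K) - (\<integral>y. mean_child P b y \<partial>?K)) / 4)"
    unfolding h by (intro has_bochner_integral_divide_zero has_bochner_integral_diff nonneg ab)
  also have "((\<integral>y. mean_child P a y \<partial>?K) - (\<integral>y. mean_child P b y \<partial>?K)) / 4 =
      (\<integral>y. (mean_child P a y - mean_child P b y) / 4 \<partial>?K)"
    using Suc.IH[OF mean_child_F[OF ab(1)]] Suc.IH[OF mean_child_F[OF ab(2)]] by simp
  also have "\<dots> = (\<integral>y. mean_child P h y \<partial>?K)"
    unfolding h by (intro Bochner_Integration.integral_cong refl mean_child_linear[symmetric] ab) (simp add: space_K)
  also have "\<dots> = (mean_child P ^^ n) (mean_child P h) x"
    using Suc.IH[OF mean_child_F[OF Suc.prems]] by (simp add: kernel_op_def)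
  finally show ?case
    by (auto simp: has_bochner_integral_iff kernel_op_def funpow_Suc_right simp del: funpow.simps)
qed

end

section \<open>Conditional independence within a generation\<close>

text \<open>The Markov property is given for real functions only. Writing each factor as real part
  plus i times imaginary part and multiplying out reduces complex products to real ones;
  \<open>B\<close> is the set of indices that contribute their real part.\<close>

lemma prod_complex_expand:
  assumes "finite A"
  shows "(\<Prod>x\<in>A. G x) = (\<Sum>B\<in>Pow A. \<i> ^ card (A - B) *
    complex_of_real (\<Prod>x\<in>A. if x \<in> B then Re (G x) else Im (G x)))"
proof -
  have "(\<Prod>x\<in>A. G x) = (\<Prod>x\<in>A. complex_of_real (Re (G x)) + \<i> * complex_of_real (Im (G x)))"
    by (intro prod.cong refl complex_eq)
  also have "\<dots> = (\<Sum>B\<in>Pow A. (\<Prod>x\<in>B. complex_of_real (Re (G x))) *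
      (\<Prod>x\<in>A - B. \<i> * complex_of_real (Im (G x))))"
    by (rule prod_add[OF assms])
  also have "\<dots> = (\<Sum>B\<in>Pow A. \<i> ^ card (A - B) *
    complex_of_real (\<Prod>x\<in>A. if x \<in> B then Re (G x) else Im (G x)))"
  proof (intro sum.cong refl)
    fix B assume B: "B \<in> Pow A"
    have "(\<Prod>x\<in>A. if x \<in> B then Re (G x) else Im (G x)) = (\<Prod>x\<in>B. Re (G x)) * (\<Prod>x\<in>A - B. Im (G x))"
      using B assms by (subst prod.If_cases) (auto simp: Int_absorb1 Diff_eq)
    then show "(\<Prod>x\<in>B. complex_of_real (Re (G x))) * (\<Prod>x\<in>A - B. \<i> * complex_of_real (Im (G x))) =
      \<i> ^ card (A - B) * complex_of_real (\<Prod>x\<in>A. if x \<in> B then Re (G x) else Im (G x))"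
      by (simp add: prod.distrib)
  qed
  finally show ?thesis .
qed

context markov_tree
begin

lemma prob_\<Omega>: "prob_space \<Omega>"
  and X_meas [measurable]: "X u \<in> \<Omega> \<rightarrow>\<^sub>M S"
  and distr_root: "distr \<Omega> S (X []) = \<nu>"
  using bmc unfolding bifurcating_markov_chain_def by auto

sublocale prob_space \<Omega> by (rule prob_\<Omega>)

lemma X_space: "\<omega> \<in> space \<Omega> \<Longrightarrow> X u \<omega> \<in> space S"
  using X_meas by (rule measurable_space)

lemma triangle_meas [measurable]: "triangle X u \<in> \<Omega> \<rightarrow>\<^sub>M S \<Otimes>\<^sub>M S \<Otimes>\<^sub>M S"
  unfolding triangle_def[abs_def] by measurable

lemma history_subalgebra: "subalgebra \<Omega> (history \<Omega> S X k)"
  unfolding subalgebra_def history_def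
  by (auto simp: space_measure_of_conv sets_measure_of_conv intro!: measurable_sets sets.sigma_sets_subset)

lemma X_history: "length u \<le> k \<Longrightarrow> X u \<in> history \<Omega> S X k \<rightarrow>\<^sub>M S"
proof (rule measurableI)
  assume u: "length u \<le> k"
  fix A assume "A \<in> sets S"
  then have "X u -` A \<inter> space \<Omega> \<in> {X j -` A \<inter> space \<Omega> | j A. j \<in> tree_upto k \<and> A \<in> sets S}"
    using u by (auto simp: tree_upto_def generation_def)
  then show "X u -` A \<inter> space (history \<Omega> S X k) \<in> sets (history \<Omega> S X k)"
    unfolding history_def by (auto simp: space_measure_of_conv intro!: in_measure_of)
qed (auto simp: history_def space_measure_of_conv X_space)

text \<open>The triangle at \<open>u\<close> also reads the children of \<open>u\<close>, one
  generation later; hence the strict inequality.\<close>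

lemma triangle_history: "length u < k \<Longrightarrow> triangle X u \<in> history \<Omega> S X k \<rightarrow>\<^sub>M S \<Otimes>\<^sub>M S \<Otimes>\<^sub>M S"
  unfolding triangle_def[abs_def] by (intro measurable_Pair X_history) auto

lemma kernel_op3_eq: "kernel_op3 P g x = (\<integral>p. g (x, p) \<partial>P x)"
  by (simp add: kernel_op3_def case_prod_unfold)

lemma section_meas:
  assumes "x \<in> space S" "g \<in> measurable (S \<Otimes>\<^sub>M S \<Otimes>\<^sub>M S) N"
  shows "(\<lambda>p. g (x, p)) \<in> measurable (P x) N"
  using measurable_compose[OF measurable_Pair1'[OF assms(1)] assms(2)] by (simp add: meas_P assms(1))

text \<open>Pushing \<open>P x\<close> forward under p -> (x, p) gives a kernel from S to the triple
  product, and the integral of a fixed function depends measurably on the measure.\<close>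

lemma kernel_integral_meas:
  fixes g :: "'s \<times> 's \<times> 's \<Rightarrow> 'b::{banach, second_countable_topology}"
  assumes g: "g \<in> borel_measurable (S \<Otimes>\<^sub>M S \<Otimes>\<^sub>M S)"
  shows "(\<lambda>x. \<integral>p. g (x, p) \<partial>P x) \<in> borel_measurable S"
proof -
  have "(\<lambda>x. distr (P x) (S \<Otimes>\<^sub>M S \<Otimes>\<^sub>M S) (\<lambda>p. (x, p))) \<in> S \<rightarrow>\<^sub>M subprob_algebra (S \<Otimes>\<^sub>M S \<Otimes>\<^sub>M S)"
    by (rule measurable_distr2[OF _ P_sub]) simp
  then have "(\<lambda>x. integral\<^sup>L (distr (P x) (S \<Otimes>\<^sub>M S \<Otimes>\<^sub>M S) (\<lambda>p. (x, p))) g) \<in> borel_measurable S"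
    by (rule measurable_compose[OF _ integral_measurable_subprob_algebra[OF g]])
  then show ?thesis
    by (rule measurable_cong[THEN iffD1, rotated])
      (simp add: integral_distr g measurable_Pair1' meas_P)
qed

lemma kernel_op3_meas:
  "g \<in> borel_measurable (S \<Otimes>\<^sub>M S \<Otimes>\<^sub>M S) \<Longrightarrow> kernel_op3 P g \<in> borel_measurable S"
  using kernel_integral_meas[of g] by (simp add: kernel_op3_eq[abs_def])

lemma kernel_integrable_bounded:
  fixes g :: "'s \<times> 's \<times> 's \<Rightarrow> 'b::{banach, second_countable_topology}"
  assumes "x \<in> space S" "g \<in> borel_measurable (S \<Otimes>\<^sub>M S \<Otimes>\<^sub>M S)"
    "\<And>t. t \<in> space (S \<Otimes>\<^sub>M S \<Otimes>\<^sub>M S) \<Longrightarrow> norm (g t) \<le> C"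
  shows "integrable (P x) (\<lambda>p. g (x, p))"
proof -
  interpret P: prob_space "P x" using prob_P[OF assms(1)] .
  show ?thesis
    using assms by (intro P.integrable_const_bound[where B=C] section_meas AE_I2)
      (auto simp: space_P space_pair_measure)
qed

lemma kernel_integral_bounded:
  fixes g :: "'s \<times> 's \<times> 's \<Rightarrow> 'b::{banach, second_countable_topology}"
  assumes "x \<in> space S" "g \<in> borel_measurable (S \<Otimes>\<^sub>M S \<Otimes>\<^sub>M S)"
    "\<And>t. t \<in> space (S \<Otimes>\<^sub>M S \<Otimes>\<^sub>M S) \<Longrightarrow> norm (g t) \<le> C"
  shows "norm (\<integral>p. g (x, p) \<partial>P x) \<le> C"
proof -
  interpret P: prob_space "P x" using prob_P[OF assms(1)] .
  have "norm (\<integral>p. g (x, p) \<partial>P x) \<le> (\<integral>p. norm (g (x, p)) \<partial>P x)"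
    by (rule integral_norm_bound)
  also have "\<dots> \<le> (\<integral>p. C \<partial>P x)"
    using assms by (intro integral_mono integrable_norm kernel_integrable_bounded[OF assms] P.integrable_const)
      (auto simp: space_P space_pair_measure)
  finally have "norm (\<integral>p. g (x, p) \<partial>P x) \<le> (\<integral>p. C \<partial>P x)" .
  then show ?thesis by (simp add: P.prob_space)
qed

text \<open>The defining conditional expectation is integrated against a bounded weight
  \<open>Z\<close> that is measurable for the past; boundedness of all factors provides the
  integrability.\<close>

lemma product_formula:
  assumes g: "\<And>u. g u \<in> borel_measurable (S \<Otimes>\<^sub>M S \<Otimes>\<^sub>M S)"
    and gC: "\<And>u t. t \<in> space (S \<Otimes>\<^sub>M S \<Otimes>\<^sub>M S) \<Longrightarrow> \<bar>g u t\<bar> \<le> C u"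
    and Z: "Z \<in> borel_measurable (history \<Omega> S X k)" and ZC: "\<And>\<omega>. \<omega> \<in> space \<Omega> \<Longrightarrow> \<bar>Z \<omega>\<bar> \<le> D"
  shows "(\<integral>\<omega>. Z \<omega> * (\<Prod>u\<in>generation k. g u (triangle X u \<omega>)) \<partial>\<Omega>) =
    (\<integral>\<omega>. Z \<omega> * (\<Prod>u\<in>generation k. kernel_op3 P (g u) (X u \<omega>)) \<partial>\<Omega>)"
proof -
  interpret finite_measure_subalgebra \<Omega> "history \<Omega> S X k"
    by unfold_locales (rule history_subalgebra)
  have Z' [measurable]: "Z \<in> borel_measurable \<Omega>"
    by (rule measurable_from_subalg[OF history_subalgebra Z])
  note g [measurable] kernel_op3_meas[OF g, measurable]
  let ?G = "\<lambda>\<omega>. \<Prod>u\<in>generation k. g u (triangle X u \<omega>)"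
  have "\<exists>C. \<forall>t\<in>space (S \<Otimes>\<^sub>M S \<Otimes>\<^sub>M S). \<bar>g u t\<bar> \<le> C" for u using gC by blast
  then have ce: "AE \<omega> in \<Omega>. real_cond_exp \<Omega> (history \<Omega> S X k) ?G \<omega>
      = (\<Prod>u\<in>generation k. kernel_op3 P (g u) (X u \<omega>))"
    using bmc g unfolding bifurcating_markov_chain_def by blast
  have int: "integrable \<Omega> (\<lambda>\<omega>. Z \<omega> * ?G \<omega>)"
  proof (rule integrable_const_bound[where B="D * (\<Prod>u\<in>generation k. C u)"])
    show "AE \<omega> in \<Omega>. norm (Z \<omega> * ?G \<omega>) \<le> D * (\<Prod>u\<in>generation k. C u)"
    proof (rule AE_I2)
      fix \<omega> assume \<omega>: "\<omega> \<in> space \<Omega>"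
      have "\<bar>?G \<omega>\<bar> \<le> (\<Prod>u\<in>generation k. C u)"
        unfolding abs_prod using gC measurable_space[OF triangle_meas \<omega>] by (intro prod_mono) auto
      then show "norm (Z \<omega> * ?G \<omega>) \<le> D * (\<Prod>u\<in>generation k. C u)"
        using ZC[OF \<omega>] by (auto simp: abs_mult intro!: mult_mono)
    qed
  qed measurable
  have "(\<integral>\<omega>. Z \<omega> * ?G \<omega> \<partial>\<Omega>) = (\<integral>\<omega>. Z \<omega> * real_cond_exp \<Omega> (history \<Omega> S X k) ?G \<omega> \<partial>\<Omega>)"
    using real_cond_exp_intg(2)[OF int Z] by simp
  also have "\<dots> = (\<integral>\<omega>. Z \<omega> * (\<Prod>u\<in>generation k. kernel_op3 P (g u) (X u \<omega>)) \<partial>\<Omega>)"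
    using ce by (intro integral_cong_AE) auto
  finally show ?thesis .
qed

text \<open>By linearity from the real case, in the weight as well as in the product. The weight
  will be the exponential of what the earlier generations contribute.\<close>

lemma product_formula_complex:
  fixes G :: "vertex \<Rightarrow> 's \<times> 's \<times> 's \<Rightarrow> complex"
  assumes G: "\<And>u. G u \<in> borel_measurable (S \<Otimes>\<^sub>M S \<Otimes>\<^sub>M S)"
    and GC: "\<And>u t. t \<in> space (S \<Otimes>\<^sub>M S \<Otimes>\<^sub>M S) \<Longrightarrow> norm (G u t) \<le> 1"
    and Z: "Z \<in> borel_measurable (history \<Omega> S X k)" and ZC: "\<And>\<omega>. \<omega> \<in> space \<Omega> \<Longrightarrow> norm (Z \<omega>) \<le> 1"
  shows "(\<integral>\<omega>. Z \<omega> * (\<Prod>u\<in>generation k. G u (triangle X u \<omega>)) \<partial>\<Omega>) =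
    (\<integral>\<omega>. Z \<omega> * (\<Prod>u\<in>generation k. \<integral>p. G u (X u \<omega>, p) \<partial>P (X u \<omega>)) \<partial>\<Omega>)"
proof -
  note G [measurable] kernel_integral_meas[OF G, measurable] measurable_from_subalg[OF history_subalgebra Z, measurable]
  let ?K = "\<lambda>u x. \<integral>p. G u (x, p) \<partial>P x"
  have KC: "norm (?K u x) \<le> 1" if "x \<in> space S" for u x
    by (rule kernel_integral_bounded[OF that G GC])
  \<comment> \<open>The real factor at \<open>u\<close> in the term of the expansion that belongs to
    the subset \<open>B\<close>.\<close>
  define g where "g B u t = (if u \<in> B then Re (G u t) else Im (G u t))" for B u t
  have g [measurable]: "g B u \<in> borel_measurable (S \<Otimes>\<^sub>M S \<Otimes>\<^sub>M S)" for B u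
    unfolding g_def[abs_def] by measurable
  have gC: "\<bar>g B u t\<bar> \<le> 1" if "t \<in> space (S \<Otimes>\<^sub>M S \<Otimes>\<^sub>M S)" for B u t
    using GC[OF that, of u] abs_Re_le_cmod[of "G u t"] abs_Im_le_cmod[of "G u t"] by (simp add: g_def)
  have Kg: "kernel_op3 P (g B u) x = (if u \<in> B then Re (?K u x) else Im (?K u x))"
    if x: "x \<in> space S" for B u x
    using kernel_integrable_bounded[OF x G GC, of u]
    by (simp add: kernel_op3_eq g_def)
  have KgC: "\<bar>kernel_op3 P (g B u) x\<bar> \<le> 1" if "x \<in> space S" for B u x
    using kernel_integral_bounded[OF that g[of B u], of 1] gC by (simp add: kernel_op3_eq)
  note kernel_op3_meas[OF g, measurable]
  \<comment> \<open>For a real weight the product is expanded over subsets, the real formula is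
    applied to each term, and the expansion is then read backwards.\<close>
  have real: "(\<integral>\<omega>. complex_of_real (z \<omega>) * (\<Prod>u\<in>generation k. G u (triangle X u \<omega>)) \<partial>\<Omega>) =
    (\<integral>\<omega>. complex_of_real (z \<omega>) * (\<Prod>u\<in>generation k. ?K u (X u \<omega>)) \<partial>\<Omega>)"
    if z: "z \<in> borel_measurable (history \<Omega> S X k)" and zC: "\<And>\<omega>. \<omega> \<in> space \<Omega> \<Longrightarrow> \<bar>z \<omega>\<bar> \<le> 1" for z
  proof -
    note measurable_from_subalg[OF history_subalgebra z, measurable]
    have bound: "\<bar>z \<omega> * (\<Prod>u\<in>generation k. a u)\<bar> \<le> 1"
      if "\<omega> \<in> space \<Omega>" "\<And>u. \<bar>a u\<bar> \<le> 1" for \<omega> a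
    proof -
      have "\<bar>\<Prod>u\<in>generation k. a u\<bar> \<le> 1"
        unfolding abs_prod using that by (intro prod_le_1) auto
      then show ?thesis using mult_mono[OF zC[OF that(1)], of "\<bar>\<Prod>u\<in>generation k. a u\<bar>" 1] by (simp add: abs_mult)
    qed
    have int1: "integrable \<Omega> (\<lambda>\<omega>. z \<omega> * (\<Prod>u\<in>generation k. g B u (triangle X u \<omega>)))" for B
      by (rule integrable_const_bound[where B=1])
        (auto intro!: bound gC measurable_space[OF triangle_meas])
    have int2: "integrable \<Omega> (\<lambda>\<omega>. z \<omega> * (\<Prod>u\<in>generation k. kernel_op3 P (g B u) (X u \<omega>)))" for B
      by (rule integrable_const_bound[where B=1]) (auto intro!: bound KgC X_space)
    have "(\<integral>\<omega>. complex_of_real (z \<omega>) * (\<Prod>u\<in>generation k. G u (triangle X u \<omega>)) \<partial>\<Omega>) =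
      (\<integral>\<omega>. (\<Sum>B\<in>Pow (generation k). \<i> ^ card (generation k - B) *
        complex_of_real (z \<omega> * (\<Prod>u\<in>generation k. g B u (triangle X u \<omega>)))) \<partial>\<Omega>)"
      by (subst prod_complex_expand) (simp_all add: sum_distrib_left g_def mult_ac)
    also have "\<dots> = (\<Sum>B\<in>Pow (generation k). \<i> ^ card (generation k - B) *
        complex_of_real (\<integral>\<omega>. z \<omega> * (\<Prod>u\<in>generation k. g B u (triangle X u \<omega>)) \<partial>\<Omega>))"
      using int1 by (subst Bochner_Integration.integral_sum)
        (auto intro!: integrable_mult_right integrable_of_real simp del: of_real_mult of_real_prod)
    also have "\<dots> = (\<Sum>B\<in>Pow (generation k). \<i> ^ card (generation k - B) *
        complex_of_real (\<integral>\<omega>. z \<omega> * (\<Prod>u\<in>generation k. kernel_op3 P (g B u) (X u \<omega>)) \<partial>\<Omega>))"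
      using product_formula[OF g gC z zC] by simp
    also have "\<dots> = (\<integral>\<omega>. (\<Sum>B\<in>Pow (generation k). \<i> ^ card (generation k - B) *
        complex_of_real (z \<omega> * (\<Prod>u\<in>generation k. kernel_op3 P (g B u) (X u \<omega>)))) \<partial>\<Omega>)"
      using int2 by (subst Bochner_Integration.integral_sum)
        (auto intro!: integrable_mult_right integrable_of_real simp del: of_real_mult of_real_prod)
    also have "\<dots> = (\<integral>\<omega>. complex_of_real (z \<omega>) * (\<Prod>u\<in>generation k. ?K u (X u \<omega>)) \<partial>\<Omega>)"
      by (intro Bochner_Integration.integral_cong refl, subst prod_complex_expand)
        (simp_all add: sum_distrib_left Kg X_space mult_ac)
    finally show ?thesis .
  qed
  have split: "(\<integral>\<omega>. Z \<omega> * Y \<omega> \<partial>\<Omega>) = (\<integral>\<omega>. complex_of_real (Re (Z \<omega>)) * Y \<omega> \<partial>\<Omega>) +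
      \<i> * (\<integral>\<omega>. complex_of_real (Im (Z \<omega>)) * Y \<omega> \<partial>\<Omega>)"
    if [measurable]: "Y \<in> borel_measurable \<Omega>" and YC: "\<And>\<omega>. \<omega> \<in> space \<Omega> \<Longrightarrow> norm (Y \<omega>) \<le> 1" for Y
  proof -
    have int: "integrable \<Omega> (\<lambda>\<omega>. complex_of_real (z \<omega>) * Y \<omega>)"
      if [measurable]: "z \<in> borel_measurable \<Omega>" and "\<And>\<omega>. \<omega> \<in> space \<Omega> \<Longrightarrow> \<bar>z \<omega>\<bar> \<le> 1" for z
      using mult_mono[OF that(2) YC] 
      by (intro integrable_const_bound[where B=1]) (auto simp: norm_mult)
    have "(\<integral>\<omega>. Z \<omega> * Y \<omega> \<partial>\<Omega>) = (\<integral>\<omega>. complex_of_real (Re (Z \<omega>)) * Y \<omega> +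
      \<i> * (complex_of_real (Im (Z \<omega>)) * Y \<omega>) \<partial>\<Omega>)"
      by (intro Bochner_Integration.integral_cong refl, subst complex_eq[of "Z _"]) (simp add: algebra_simps)
    also have "\<dots> = (\<integral>\<omega>. complex_of_real (Re (Z \<omega>)) * Y \<omega> \<partial>\<Omega>) +
      \<i> * (\<integral>\<omega>. complex_of_real (Im (Z \<omega>)) * Y \<omega> \<partial>\<Omega>)"
      using order_trans[OF abs_Re_le_cmod ZC] order_trans[OF abs_Im_le_cmod ZC]
      by (subst Bochner_Integration.integral_add) (auto intro!: int integrable_mult_right)
    finally show ?thesis .
  qed
  have zz: "(\<lambda>\<omega>. Re (Z \<omega>)) \<in> borel_measurable (history \<Omega> S X k)"
    "(\<lambda>\<omega>. Im (Z \<omega>)) \<in> borel_measurable (history \<Omega> S X k)"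
    using Z by measurable
  show ?thesis
    using order_trans[OF abs_Re_le_cmod ZC] order_trans[OF abs_Im_le_cmod ZC]
      measurable_space[OF triangle_meas] KC[OF X_space] GC
    by (simp add: split norm_prod_le[THEN order_trans] real[OF zz(1)] real[OF zz(2)]
        prod_norm[symmetric] prod_le_1)
qed

text \<open>The vertices outside \<open>I\<close> receive the constant factor 1, which a probability
  kernel preserves. Singletons will give the law of a child and the diagonal terms of second
  moments, pairs the off-diagonal terms.\<close>

lemma product_formula_subset:
  assumes g: "\<And>u. g u \<in> borel_measurable (S \<Otimes>\<^sub>M S \<Otimes>\<^sub>M S)"
    and gC: "\<And>u t. t \<in> space (S \<Otimes>\<^sub>M S \<Otimes>\<^sub>M S) \<Longrightarrow> \<bar>g u t\<bar> \<le> C u"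
    and I: "I \<subseteq> generation k"
  shows "(\<integral>\<omega>. (\<Prod>u\<in>I. g u (triangle X u \<omega>)) \<partial>\<Omega>) = (\<integral>\<omega>. (\<Prod>u\<in>I. kernel_op3 P (g u) (X u \<omega>)) \<partial>\<Omega>)"
proof -
  define g' where "g' u = (if u \<in> I then g u else (\<lambda>_. 1))" for u
  have K1: "kernel_op3 P (g' u) x = (if u \<in> I then kernel_op3 P (g u) x else 1)" if "x \<in> space S" for u x
    using prob_space.prob_space[OF prob_P[OF that]] by (simp add: kernel_op3_eq g'_def)
  have restr: "(\<Prod>u\<in>generation k. if u \<in> I then a u else 1) = (\<Prod>u\<in>I. a u)" for a :: "vertex \<Rightarrow> real"
    using I by (simp add: Int_absorb1 flip: prod.inter_restrict)
  have "(\<integral>\<omega>. 1 * (\<Prod>u\<in>generation k. g' u (triangle X u \<omega>)) \<partial>\<Omega>) =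
    (\<integral>\<omega>. 1 * (\<Prod>u\<in>generation k. kernel_op3 P (g' u) (X u \<omega>)) \<partial>\<Omega>)"
    by (rule product_formula[where C="\<lambda>u. max 1 (C u)" and D=1])
      (use g gC in \<open>auto simp: g'_def le_max_iff_disj\<close>)
  moreover have "(\<integral>\<omega>. (\<Prod>u\<in>generation k. kernel_op3 P (g' u) (X u \<omega>)) \<partial>\<Omega>) =
    (\<integral>\<omega>. (\<Prod>u\<in>I. kernel_op3 P (g u) (X u \<omega>)) \<partial>\<Omega>)"
    by (intro Bochner_Integration.integral_cong refl) (simp add: K1 X_space restr)
  ultimately show ?thesis
    by (simp add: g'_def if_distrib[of "\<lambda>h. h (triangle X _ _)"] restr cong: if_cong)
qed

end

section \<open>Second moments of generation sums\<close>

text \<open>The analogue of \<open>tree_sum\<close> over one generation for functions of the vertex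
  value alone instead of the triangle.\<close>

definition level_sum :: "(vertex \<Rightarrow> 'w \<Rightarrow> 's) \<Rightarrow> nat \<Rightarrow> ('s \<Rightarrow> real) \<Rightarrow> 'w \<Rightarrow> real" where
  "level_sum X k h \<omega> = (\<Sum>u\<in>generation k. h (X u \<omega>))"

lemma level_sum_scale: "level_sum X k (\<lambda>x. c * h x) \<omega> = c * level_sum X k h \<omega>"
  by (simp add: level_sum_def sum_distrib_left)

text \<open>Clipping at height n produces the bounded approximations to which the defining property
  of the chain applies directly.\<close>

definition truncate :: "nat \<Rightarrow> real \<Rightarrow> real" where
  "truncate n y = max (- real n) (min (real n) y)"

lemma truncate_meas [measurable]: "truncate n \<in> borel_measurable borel"
  unfolding truncate_def[abs_def] by measurable

lemma abs_truncate_le: "\<bar>truncate n y\<bar> \<le> real n" "\<bar>truncate n y\<bar> \<le> \<bar>y\<bar>"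
  by (auto simp: truncate_def)

lemma tendsto_truncate: "(\<lambda>n. truncate n y) \<longlonglongrightarrow> y"
proof (rule tendsto_eventually)
  obtain N :: nat where "\<bar>y\<bar> \<le> real N" using real_arch_simple by blast
  then show "\<forall>\<^sub>F n in sequentially. truncate n y = y"
    by (auto simp: eventually_sequentially truncate_def intro!: exI[of _ N])
qed

lemma power2_half_sum_le: "((a + b) / 2)\<^sup>2 \<le> (a\<^sup>2 + b\<^sup>2) / (2 :: real)"
  using zero_le_power2[of "a - b"] by (simp add: power2_eq_square field_simps)

section \<open>Laws and expectations of single vertices and of generation sums\<close>

context markov_tree
begin

text \<open>The Markov property at the single vertex \<open>u\<close>, tested on indicators of the
  position of one child. Here \<open>b\<close> is the appended letter, so \<open>True\<close>
  selects \<open>snd\<close>. As an identity of measures it extends from bounded functions to the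
  unbounded elements of \<open>F\<close>.\<close>

lemma distr_child:
  "distr \<Omega> S (X (u @ [b])) =
    distr \<Omega> S (X u) \<bind> (\<lambda>x. distr (P x) S (if b then snd else fst))"
proof -
  let ?L = "distr \<Omega> S (X u)" and ?N = "\<lambda>x. distr (P x) S (if b then snd else fst)"
  let ?sel = "if b then snd else fst :: 's \<times> 's \<Rightarrow> 's"
  have sel [measurable]: "?sel \<in> S \<Otimes>\<^sub>M S \<rightarrow>\<^sub>M S" by simp
  have N: "?N \<in> S \<rightarrow>\<^sub>M prob_algebra S"
    using P by measurable
  have L: "?L \<in> space (prob_algebra S)"
    by (auto simp: space_prob_algebra intro!: prob_space_distr)
  show ?thesis
  proof (rule measure_eqI)
    show "sets (distr \<Omega> S (X (u @ [b]))) = sets (?L \<bind> ?N)"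
      using sets_bind'[OF L N] by simp
  next
    fix A assume "A \<in> sets (distr \<Omega> S (X (u @ [b])))"
    then have A [measurable]: "A \<in> sets S" by simp
    define g where "g t = indicat_real A (?sel (snd t))" for t :: "'s \<times> 's \<times> 's"
    have g [measurable]: "g \<in> borel_measurable (S \<Otimes>\<^sub>M S \<Otimes>\<^sub>M S)"
      unfolding g_def[abs_def] by measurable
    have g1: "\<bar>g t\<bar> \<le> 1" for t by (simp add: g_def)
    have "(\<integral>\<omega>. g (triangle X u \<omega>) \<partial>\<Omega>) = (\<integral>\<omega>. kernel_op3 P g (X u \<omega>) \<partial>\<Omega>)"
      using product_formula_subset[of "\<lambda>_. g" "\<lambda>_. 1" "{u}" "length u"] g1
      by (simp add: generation_def)
    moreover have "g (triangle X u \<omega>) = indicat_real (X (u @ [b]) -` A \<inter> space \<Omega>) \<omega>"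
      if "\<omega> \<in> space \<Omega>" for \<omega>
      using that by (auto simp: g_def triangle_def indicator_def)
    then have "(\<integral>\<omega>. g (triangle X u \<omega>) \<partial>\<Omega>) = measure \<Omega> (X (u @ [b]) -` A \<inter> space \<Omega>)"
      by (subst Bochner_Integration.integral_cong[OF refl]) auto
    moreover have K: "kernel_op3 P g x = measure (?N x) A" if x: "x \<in> space S" for x
    proof -
      have "kernel_op3 P g x = (\<integral>p. indicat_real (?sel -` A \<inter> space (P x)) p \<partial>P x)"
        unfolding kernel_op3_eq by (intro Bochner_Integration.integral_cong refl) (auto simp: g_def indicator_def)
      then show ?thesis
        using measurable_sets[OF sel A] by (simp add: measure_distr meas_P[OF x] space_P[OF x] sets_P[OF x] space_pair_measure)
    qed
    then have "(\<integral>\<omega>. kernel_op3 P g (X u \<omega>) \<partial>\<Omega>) = (\<integral>\<omega>. measure (?N (X u \<omega>)) A \<partial>\<Omega>)"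
      by (intro Bochner_Integration.integral_cong refl) (simp add: X_space)
    moreover have "(\<integral>\<omega>. measure (?N (X u \<omega>)) A \<partial>\<Omega>) = (\<integral>x. measure (?N x) A \<partial>?L)"
      using N by (subst integral_distr) auto
    ultimately have eq: "measure \<Omega> (X (u @ [b]) -` A \<inter> space \<Omega>) = (\<integral>x. measure (?N x) A \<partial>?L)"
      by simp
    interpret L: prob_space ?L by (rule prob_space_distr) simp
    have N': "?N \<in> ?L \<rightarrow>\<^sub>M subprob_algebra S"
      using measurable_prob_algebraD[OF N] by simp
    interpret LN: prob_space "?L \<bind> ?N" by (rule prob_space_bind'[OF L N])
    show "emeasure (distr \<Omega> S (X (u @ [b]))) A = emeasure (?L \<bind> ?N) A"
      using eq L.measure_bind[OF N' A]
      by (simp add: emeasure_distr emeasure_eq_measure LN.emeasure_eq_measure)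
  qed
qed

lemma F_child_mean:
  assumes "h \<in> F"
  shows "(\<lambda>x. \<integral>p. h (if b then snd p else fst p) \<partial>P x) \<in> F"
  using F_children[OF assms] by (cases b) auto

lemma F_child_integrable:
  assumes "h \<in> F" "x \<in> space S"
  shows "integrable (P x) (\<lambda>p. h (if b then snd p else fst p))"
  using F_children_integrable[OF assms] by (cases b) auto

text \<open>Nonnegative integrals are used because integrability at the child is not yet known; it
  will be deduced from this identity.\<close>

lemma nn_integral_child:
  assumes a: "a \<in> F" "\<And>x. 0 \<le> a x"
  shows "(\<integral>\<^sup>+\<omega>. ennreal (a (X (u @ [b]) \<omega>)) \<partial>\<Omega>) =
    (\<integral>\<^sup>+\<omega>. ennreal (\<integral>p. a (if b then snd p else fst p) \<partial>P (X u \<omega>)) \<partial>\<Omega>)"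
proof -
  let ?N = "\<lambda>x. distr (P x) S (if b then snd else fst)"
  have sel [measurable]: "(if b then snd else fst) \<in> S \<Otimes>\<^sub>M S \<rightarrow>\<^sub>M S" by simp
  have "?N \<in> S \<rightarrow>\<^sub>M prob_algebra S"
    using P by measurable
  then have N [measurable]: "?N \<in> S \<rightarrow>\<^sub>M subprob_algebra S"
    by (rule measurable_prob_algebraD)
  note F_meas[OF a(1), measurable]
  have "(\<integral>\<^sup>+\<omega>. ennreal (a (X (u @ [b]) \<omega>)) \<partial>\<Omega>) = (\<integral>\<^sup>+x. ennreal (a x) \<partial>distr \<Omega> S (X (u @ [b])))"
    by (simp add: nn_integral_distr)
  also have "\<dots> = (\<integral>\<^sup>+x. \<integral>\<^sup>+y. ennreal (a y) \<partial>?N x \<partial>distr \<Omega> S (X u))"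
    unfolding distr_child by (rule nn_integral_bind[where B=S]) auto
  also have "\<dots> = (\<integral>\<^sup>+\<omega>. \<integral>\<^sup>+y. ennreal (a y) \<partial>?N (X u \<omega>) \<partial>\<Omega>)"
    by (rule nn_integral_distr) measurable
  also have "\<dots> = (\<integral>\<^sup>+\<omega>. ennreal (\<integral>p. a (if b then snd p else fst p) \<partial>P (X u \<omega>)) \<partial>\<Omega>)"
  proof (rule nn_integral_cong)
    fix \<omega> assume "\<omega> \<in> space \<Omega>"
    then have x: "X u \<omega> \<in> space S" by (rule X_space)
    have "(\<integral>\<^sup>+y. ennreal (a y) \<partial>?N (X u \<omega>)) = (\<integral>\<^sup>+p. ennreal (a (if b then snd p else fst p)) \<partial>P (X u \<omega>))"
      by (subst nn_integral_distr) (auto simp: meas_P[OF x])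
    also have "\<dots> = ennreal (\<integral>p. a (if b then snd p else fst p) \<partial>P (X u \<omega>))"
      by (intro nn_integral_eq_integral F_child_integrable a x) (simp add: a(2))
    finally show "(\<integral>\<^sup>+y. ennreal (a y) \<partial>?N (X u \<omega>)) = \<dots>" .
  qed
  finally show ?thesis .
qed

text \<open>Induction along the path from the root: at the root this is the inclusion of
  \<open>F\<close> in the integrable functions of \<nu>, and removing the last letter replaces h by
  its mean over that child, again an element of \<open>F\<close>.\<close>

lemma F_X_integrable: "h \<in> F \<Longrightarrow> integrable \<Omega> (\<lambda>\<omega>. h (X u \<omega>))"
proof (induction u arbitrary: h rule: rev_induct)
  case Nil
  then have "integrable (distr \<Omega> S (X [])) h"
    using F_integrable_\<nu> by (simp add: distr_root)
  then show ?case
    using F_meas[OF Nil] by (simp add: integrable_distr_eq)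
next
  case (snoc b u)
  obtain a a' where aa: "a \<in> F" "a' \<in> F" "\<And>x. 0 \<le> a x" "\<And>x. 0 \<le> a' x"
    and h: "h = (\<lambda>x. (a x - a' x) / 4)" using F_polarization[OF snoc.prems] by blast
  have nonneg: "integrable \<Omega> (\<lambda>\<omega>. a (X (u @ [b]) \<omega>))" if a: "a \<in> F" "\<And>x. 0 \<le> a x" for a
  proof -
    note F_meas[OF a(1), measurable]
    have "(\<integral>\<^sup>+\<omega>. ennreal (a (X (u @ [b]) \<omega>)) \<partial>\<Omega>) < \<infinity>"
      unfolding nn_integral_child[OF a] using snoc.IH[OF F_child_mean[OF a(1), of b]]
      by (subst nn_integral_eq_integral) (auto simp: a(2) intro!: integral_nonneg_AE)
    then show ?thesis
      by (intro integrableI_bounded) (auto simp: a(2))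
  qed
  show ?case
    unfolding h by (intro integrable_divide_zero Bochner_Integration.integrable_diff nonneg aa)
qed

lemma expectation_child:
  assumes "h \<in> F"
  shows "expectation (\<lambda>\<omega>. h (X (u @ [b]) \<omega>)) =
    expectation (\<lambda>\<omega>. \<integral>p. h (if b then snd p else fst p) \<partial>P (X u \<omega>))"
proof -
  obtain a a' where aa: "a \<in> F" "a' \<in> F" "\<And>x. 0 \<le> a x" "\<And>x. 0 \<le> a' x"
    and h: "h = (\<lambda>x. (a x - a' x) / 4)" using F_polarization[OF assms] by blast
  have nonneg: "expectation (\<lambda>\<omega>. a (X (u @ [b]) \<omega>)) =
    expectation (\<lambda>\<omega>. \<integral>p. a (if b then snd p else fst p) \<partial>P (X u \<omega>))"
    if a: "a \<in> F" "\<And>x. 0 \<le> a x" for a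
    using nn_integral_child[OF a, of u b] F_X_integrable[OF a(1), of "u @ [b]"]
      F_X_integrable[OF F_child_mean[OF a(1), of b], of u]
    by (simp add: nn_integral_eq_integral a(2) integral_nonneg_AE)
  have "(\<integral>p. h (if b then snd p else fst p) \<partial>P x) =
    ((\<integral>p. a (if b then snd p else fst p) \<partial>P x) - (\<integral>p. a' (if b then snd p else fst p) \<partial>P x)) / 4"
    if "x \<in> space S" for x
    unfolding h using F_child_integrable[OF aa(1) that, of b] F_child_integrable[OF aa(2) that, of b] by simp
  then have "expectation (\<lambda>\<omega>. \<integral>p. h (if b then snd p else fst p) \<partial>P (X u \<omega>)) =
    expectation (\<lambda>\<omega>. ((\<integral>p. a (if b then snd p else fst p) \<partial>P (X u \<omega>)) -
      (\<integral>p. a' (if b then snd p else fst p) \<partial>P (X u \<omega>))) / 4)"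
    by (intro Bochner_Integration.integral_cong refl) (simp add: X_space)
  also have "\<dots> = (expectation (\<lambda>\<omega>. a (X (u @ [b]) \<omega>)) - expectation (\<lambda>\<omega>. a' (X (u @ [b]) \<omega>))) / 4"
    using F_X_integrable[OF F_child_mean[OF aa(1), of b], of u] F_X_integrable[OF F_child_mean[OF aa(2), of b], of u]
    by (simp add: nonneg aa)
  also have "\<dots> = expectation (\<lambda>\<omega>. h (X (u @ [b]) \<omega>))"
    unfolding h using F_X_integrable[OF aa(1), of "u @ [b]"] F_X_integrable[OF aa(2), of "u @ [b]"] by simp
  finally show ?thesis by simp
qed

lemma level_sum_integrable: "h \<in> F \<Longrightarrow> integrable \<Omega> (level_sum X k h)"
  unfolding level_sum_def[abs_def] by (intro Bochner_Integration.integrable_sum F_X_integrable)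

lemma level_sum_meas:
  assumes [measurable]: "h \<in> borel_measurable S"
  shows "level_sum X k h \<in> borel_measurable \<Omega>"
  unfolding level_sum_def[abs_def] by measurable

lemma expectation_level_sum_Suc:
  assumes h: "h \<in> F"
  shows "expectation (level_sum X (Suc k) h) = 2 * expectation (level_sum X k (mean_child P h))"
proof -
  have "expectation (level_sum X (Suc k) h) =
    (\<Sum>u\<in>generation k. expectation (\<lambda>\<omega>. h (X (u @ [False]) \<omega>)) + expectation (\<lambda>\<omega>. h (X (u @ [True]) \<omega>)))"
    unfolding level_sum_def[abs_def] sum_generation_Suc using F_X_integrable[OF h]
    by (simp add: Bochner_Integration.integral_sum)
  also have "\<dots> = (\<Sum>u\<in>generation k. expectation (\<lambda>\<omega>. 2 * mean_child P h (X u \<omega>)))"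
    using F_X_integrable[OF F_children(1)[OF h]] F_X_integrable[OF F_children(2)[OF h]]
    by (intro sum.cong refl) (simp add: expectation_child[OF h] mean_child_def)
  also have "\<dots> = 2 * expectation (level_sum X k (mean_child P h))"
    unfolding level_sum_def[abs_def] using F_X_integrable[OF mean_child_F[OF h]]
    by (simp add: Bochner_Integration.integral_sum sum_distrib_left)
  finally show ?thesis .
qed

lemma expectation_root: "h \<in> borel_measurable S \<Longrightarrow> expectation (\<lambda>\<omega>. h (X [] \<omega>)) = (\<integral>x. h x \<partial>\<nu>)" for h :: "'s \<Rightarrow> real"
  by (simp add: integral_distr flip: distr_root)

lemma expectation_level_sum:
  "h \<in> F \<Longrightarrow> expectation (level_sum X k h) = 2 ^ k * (\<integral>x. (mean_child P ^^ k) h x \<partial>\<nu>)"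
proof (induction k arbitrary: h)
  case 0
  then show ?case
    by (simp add: level_sum_def[abs_def] generation_0 expectation_root F_meas)
next
  case (Suc k)
  then show ?case
    by (simp add: expectation_level_sum_Suc mean_child_F funpow_Suc_right del: funpow.simps)
qed

lemma space_\<nu>: "space \<nu> = space S" and space_\<mu>: "space \<mu> = space S"
  and prob_\<nu>: "prob_space \<nu>" and prob_\<mu>: "prob_space \<mu>"
  using \<nu> ergodic by (auto simp: geometric_ergodicity_def space_prob_algebra dest: sets_eq_imp_space_eq)

lemma F_integrable_\<mu>: "h \<in> F \<Longrightarrow> integrable \<mu> h"
  and \<alpha>: "0 < \<alpha>" "\<alpha> < 1"
  using ergodic by (auto simp: geometric_ergodicity_def)

text \<open>Ergodicity bounds all iterates of h by the one function |<\<mu>, h>| + g, since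
  \<alpha>^k <= 1. This function lies in \<open>F\<close>, and its \<nu>-integral is the constant
  \<open>B\<close>.\<close>

lemma expectation_level_sum_bounded:
  assumes h: "h \<in> F"
  shows "\<exists>B\<ge>0. \<forall>k. expectation (level_sum X k h) \<le> 2 ^ k * B"
proof -
  interpret N: prob_space \<nu> by (rule prob_\<nu>)
  obtain g where g: "g \<in> F" and le: "\<And>n x. x \<in> space S \<Longrightarrow>
      \<bar>kernel_op (kernel_pow S (induced_kernel S P) n) h x - (\<integral>y. h y \<partial>\<mu>)\<bar> \<le> \<alpha> ^ n * g x"
    using ergodic h unfolding geometric_ergodicity_def by blast
  \<comment> \<open>The case n = 0 bounds an absolute value by \<open>g x\<close>.\<close>
  have g0: "0 \<le> g x" if "x \<in> space S" for x
    using le[OF that, of 0] by simp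
  have "(mean_child P ^^ k) h x \<le> \<bar>\<integral>y. h y \<partial>\<mu>\<bar> + g x" if x: "x \<in> space S" for k x
  proof -
    have "\<alpha> ^ k * g x \<le> 1 * g x"
      using \<alpha> g0[OF x] by (intro mult_right_mono power_le_one) auto
    then show ?thesis
      using le[OF x, of k] kernel_pow_F[OF h x, of k] by simp
  qed
  then have "(\<integral>x. (mean_child P ^^ k) h x \<partial>\<nu>) \<le> (\<integral>x. \<bar>\<integral>y. h y \<partial>\<mu>\<bar> + g x \<partial>\<nu>)" for k
    by (intro integral_mono F_integrable_\<nu> mean_child_pow_F F_add F_const h g) (simp add: space_\<nu>)
  moreover have "0 \<le> (\<integral>x. \<bar>\<integral>y. h y \<partial>\<mu>\<bar> + g x \<partial>\<nu>)"
    using g0 by (intro Bochner_Integration.integral_nonneg) (simp add: space_\<nu>)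
  ultimately show ?thesis
    by (intro exI[of _ "\<integral>x. \<bar>\<integral>y. h y \<partial>\<mu>\<bar> + g x \<partial>\<nu>"]) (simp add: expectation_level_sum[OF h])
qed

section \<open>A recursive inequality for second moments\<close>

lemma level_sum_mono:
  "\<omega> \<in> space \<Omega> \<Longrightarrow> (\<And>x. x \<in> space S \<Longrightarrow> h x \<le> h' x) \<Longrightarrow> level_sum X k h \<omega> \<le> level_sum X k h' \<omega>"
  unfolding level_sum_def by (intro sum_mono) (auto intro: X_space)

text \<open>Generation k + 1 is summed by pairs of siblings and the square is expanded over pairs of
  parents. Triangles at distinct parents are independent given the past, so each may be averaged
  separately; the diagonal only costs the conditional second moment of a sibling pair.\<close>

lemma second_moment_bounded:
  assumes h [measurable]: "h \<in> borel_measurable S" and C: "\<And>x. \<bar>h x\<bar> \<le> C"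
  shows "expectation (\<lambda>\<omega>. (level_sum X (Suc k) h \<omega>)\<^sup>2) \<le>
    4 * expectation (\<lambda>\<omega>. (level_sum X k (mean_child P h) \<omega>)\<^sup>2) +
    4 * expectation (level_sum X k (mean_child P (\<lambda>x. (h x)\<^sup>2)))"
proof -
  \<comment> \<open>The contribution of one sibling pair, as a function of the triangle at its
    parent.\<close>
  define G where "G t = h (fst (snd t)) + h (snd (snd t))" for t :: "'s \<times> 's \<times> 's"
  define G2 where "G2 t = (G t)\<^sup>2" for t
  have G [measurable]: "G \<in> borel_measurable (S \<Otimes>\<^sub>M S \<Otimes>\<^sub>M S)" "G2 \<in> borel_measurable (S \<Otimes>\<^sub>M S \<Otimes>\<^sub>M S)"
    unfolding G_def[abs_def] G2_def[abs_def] by measurable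
  define D where "D = 2 * C"
  have GC: "\<bar>G t\<bar> \<le> D" for t
    using C[of "fst (snd t)"] C[of "snd (snd t)"] by (simp add: G_def D_def)
  have G2C: "\<bar>G2 t\<bar> \<le> D\<^sup>2" for t
    using power_mono[OF GC, of t 2] by (simp add: G2_def)
  have intc: "integrable (P x) (\<lambda>p. h (fst p))" "integrable (P x) (\<lambda>p. h (snd p))"
    "integrable (P x) (\<lambda>p. (h (fst p))\<^sup>2)" "integrable (P x) (\<lambda>p. (h (snd p))\<^sup>2)" if x: "x \<in> space S" for x
  proof -
    have C2: "norm ((h y)\<^sup>2) \<le> C\<^sup>2" for y using power_mono[OF C, of y 2] by simp
    show "integrable (P x) (\<lambda>p. h (fst p))"
      using kernel_integrable_bounded[OF x, of "\<lambda>t. h (fst (snd t))" C] C by simp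
    show "integrable (P x) (\<lambda>p. h (snd p))"
      using kernel_integrable_bounded[OF x, of "\<lambda>t. h (snd (snd t))" C] C by simp
    show "integrable (P x) (\<lambda>p. (h (fst p))\<^sup>2)"
      using kernel_integrable_bounded[OF x, of "\<lambda>t. (h (fst (snd t)))\<^sup>2" "C\<^sup>2"] C2 by simp
    show "integrable (P x) (\<lambda>p. (h (snd p))\<^sup>2)"
      using kernel_integrable_bounded[OF x, of "\<lambda>t. (h (snd (snd t)))\<^sup>2" "C\<^sup>2"] C2 by simp
  qed
  have K: "kernel_op3 P G x = 2 * mean_child P h x" if "x \<in> space S" for x
    using intc[OF that] by (simp add: kernel_op3_eq G_def mean_child_def)
  have K2: "kernel_op3 P G2 x \<le> 4 * mean_child P (\<lambda>x. (h x)\<^sup>2) x" if x: "x \<in> space S" for x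
  proof -
    have "kernel_op3 P G2 x \<le> (\<integral>p. 2 * ((h (fst p))\<^sup>2 + (h (snd p))\<^sup>2) \<partial>P x)"
      unfolding kernel_op3_eq
    proof (rule integral_mono)
      show "integrable (P x) (\<lambda>p. G2 (x, p))"
        by (rule kernel_integrable_bounded[OF x G(2)]) (simp only: real_norm_def, rule G2C)
      show "G2 (x, p) \<le> 2 * ((h (fst p))\<^sup>2 + (h (snd p))\<^sup>2)" for p
        using power2_half_sum_le[of "h (fst p)" "h (snd p)"]
        by (simp add: G2_def G_def power_divide)
    qed (use intc[OF x] in simp)
    also have "\<dots> = 4 * mean_child P (\<lambda>x. (h x)\<^sup>2) x"
      using intc[OF x] by (simp add: mean_child_def)
    finally show ?thesis .
  qed
  note KM [measurable] = kernel_op3_meas[OF G(1)] kernel_op3_meas[OF G(2)]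
  have KC: "\<bar>kernel_op3 P G x\<bar> \<le> D" if "x \<in> space S" for x
    using kernel_integral_bounded[OF that G(1), of "D"] GC by (simp add: kernel_op3_eq)
  have K2C: "\<bar>kernel_op3 P G2 x\<bar> \<le> D\<^sup>2" if "x \<in> space S" for x
    using kernel_integral_bounded[OF that G(2), of "D\<^sup>2"] G2C by (simp add: kernel_op3_eq)
  \<comment> \<open>\<open>C\<close> bounds |h| everywhere, so any point serves.\<close>
  have D0: "0 \<le> D" using C[of undefined] by (simp add: D_def)
  have int_GG: "integrable \<Omega> (\<lambda>\<omega>. G (triangle X u \<omega>) * G (triangle X v \<omega>))" for u v
    by (rule integrable_const_bound[where B="D * D"])
      (auto simp: abs_mult D0 intro!: AE_I2 mult_mono GC)
  have int_KK: "integrable \<Omega> (\<lambda>\<omega>. kernel_op3 P G (X u \<omega>) * kernel_op3 P G (X v \<omega>))" for u v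
    by (rule integrable_const_bound[where B="D * D"])
      (auto simp: abs_mult D0 intro!: AE_I2 mult_mono KC X_space)
  have int_K2: "integrable \<Omega> (\<lambda>\<omega>. kernel_op3 P G2 (X u \<omega>))" for u
    by (rule integrable_const_bound[where B="D\<^sup>2"])
      (auto simp: intro!: AE_I2 K2C X_space)
  \<comment> \<open>On the diagonal a nonnegative square is added, so that the right-hand products
    form the complete square of one sum.\<close>
  have pair: "expectation (\<lambda>\<omega>. G (triangle X u \<omega>) * G (triangle X v \<omega>)) \<le>
      expectation (\<lambda>\<omega>. kernel_op3 P G (X u \<omega>) * kernel_op3 P G (X v \<omega>)) +
      (if u = v then expectation (\<lambda>\<omega>. kernel_op3 P G2 (X u \<omega>)) else 0)"
    if uv: "u \<in> generation k" "v \<in> generation k" for u v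
  proof (cases "u = v")
    case True
    have "expectation (\<lambda>\<omega>. G2 (triangle X u \<omega>)) = expectation (\<lambda>\<omega>. kernel_op3 P G2 (X u \<omega>))"
      using product_formula_subset[of "\<lambda>_. G2" "\<lambda>_. D\<^sup>2" "{u}" k] G2C uv by simp
    moreover have "0 \<le> expectation (\<lambda>\<omega>. kernel_op3 P G (X u \<omega>) * kernel_op3 P G (X u \<omega>))"
      by (intro Bochner_Integration.integral_nonneg) simp
    ultimately show ?thesis
      using True by (simp add: G2_def power2_eq_square)
  next
    case False
    then show ?thesis
      using product_formula_subset[of "\<lambda>_. G" "\<lambda>_. D" "{u, v}" k] GC uv by simp
  qed
  have sq: "expectation (\<lambda>\<omega>. (\<Sum>u\<in>generation k. a u \<omega>)\<^sup>2) =
      (\<Sum>u\<in>generation k. \<Sum>v\<in>generation k. expectation (\<lambda>\<omega>. a u \<omega> * a v \<omega>))"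
    if "\<And>u v. integrable \<Omega> (\<lambda>\<omega>. a u \<omega> * a v \<omega>)" for a :: "vertex \<Rightarrow> 'w \<Rightarrow> real"
    using that by (simp add: power2_eq_square sum_product)
  have "expectation (\<lambda>\<omega>. (level_sum X (Suc k) h \<omega>)\<^sup>2) =
      expectation (\<lambda>\<omega>. (\<Sum>u\<in>generation k. G (triangle X u \<omega>))\<^sup>2)"
    by (simp add: level_sum_def sum_generation_Suc G_def triangle_def)
  also have "\<dots> \<le> (\<Sum>u\<in>generation k. \<Sum>v\<in>generation k.
      expectation (\<lambda>\<omega>. kernel_op3 P G (X u \<omega>) * kernel_op3 P G (X v \<omega>)) +
      (if u = v then expectation (\<lambda>\<omega>. kernel_op3 P G2 (X u \<omega>)) else 0))"
    unfolding sq[OF int_GG] by (intro sum_mono pair)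
  also have "\<dots> = expectation (\<lambda>\<omega>. (\<Sum>u\<in>generation k. kernel_op3 P G (X u \<omega>))\<^sup>2) +
      expectation (\<lambda>\<omega>. \<Sum>u\<in>generation k. kernel_op3 P G2 (X u \<omega>))"
    unfolding sq[OF int_KK] using int_K2 by (simp add: sum.distrib)
  also have "expectation (\<lambda>\<omega>. (\<Sum>u\<in>generation k. kernel_op3 P G (X u \<omega>))\<^sup>2) =
      expectation (\<lambda>\<omega>. 4 * (level_sum X k (mean_child P h) \<omega>)\<^sup>2)"
    by (intro Bochner_Integration.integral_cong refl)
      (simp add: K X_space level_sum_def power_mult_distrib flip: sum_distrib_left)
  also have "expectation (\<lambda>\<omega>. \<Sum>u\<in>generation k. kernel_op3 P G2 (X u \<omega>)) \<le>
      expectation (\<lambda>\<omega>. 4 * level_sum X k (mean_child P (\<lambda>x. (h x)\<^sup>2)) \<omega>)"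
  proof (rule integral_mono)
    \<comment> \<open>Both child integrals are merged into one integral over triples, which gives
      measurability and the bound by the squared constant.\<close>
    have mc: "mean_child P (\<lambda>x. (h x)\<^sup>2) x = kernel_op3 P (\<lambda>t. ((h (fst (snd t)))\<^sup>2 + (h (snd (snd t)))\<^sup>2) / 2) x"
      if "x \<in> space S" for x
      using intc[OF that] by (simp add: mean_child_def kernel_op3_eq add_divide_distrib)
    have mcC: "\<bar>mean_child P (\<lambda>x. (h x)\<^sup>2) x\<bar> \<le> C\<^sup>2" if "x \<in> space S" for x
    proof -
      have "norm (((h (fst (snd t)))\<^sup>2 + (h (snd (snd t)))\<^sup>2) / 2) \<le> C\<^sup>2" for t :: "'s \<times> 's \<times> 's"
        using power_mono[OF C, of "fst (snd t)" 2] power_mono[OF C, of "snd (snd t)" 2] by simp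
      then show ?thesis
        using kernel_integral_bounded[OF that, of "\<lambda>t. ((h (fst (snd t)))\<^sup>2 + (h (snd (snd t)))\<^sup>2) / 2" "C\<^sup>2"]
        by (simp add: mc[OF that] kernel_op3_eq)
    qed
    have "mean_child P (\<lambda>x. (h x)\<^sup>2) \<in> borel_measurable S"
      by (subst measurable_cong[OF mc]) (auto intro!: kernel_op3_meas)
    then have "integrable \<Omega> (\<lambda>\<omega>. mean_child P (\<lambda>x. (h x)\<^sup>2) (X u \<omega>))" for u
      by (intro integrable_const_bound[where B="C\<^sup>2"]) (auto intro!: AE_I2 mcC X_space)
    then show "integrable \<Omega> (\<lambda>\<omega>. 4 * level_sum X k (mean_child P (\<lambda>x. (h x)\<^sup>2)) \<omega>)"
      unfolding level_sum_def by simp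
    show "integrable \<Omega> (\<lambda>\<omega>. \<Sum>u\<in>generation k. kernel_op3 P G2 (X u \<omega>))"
      using int_K2 by simp
    show "(\<Sum>u\<in>generation k. kernel_op3 P G2 (X u \<omega>)) \<le> 4 * level_sum X k (mean_child P (\<lambda>x. (h x)\<^sup>2)) \<omega>"
      if "\<omega> \<in> space \<Omega>" for \<omega>
      unfolding level_sum_def sum_distrib_left by (intro sum_mono K2 X_space that)
  qed
  finally show ?thesis by simp
qed

end

text \<open>Nonnegativity of the variance.\<close>

lemma (in prob_space) expectation_power2_le:
  fixes f :: "'a \<Rightarrow> real"
  assumes "integrable M f" "integrable M (\<lambda>x. (f x)\<^sup>2)"
  shows "(expectation f)\<^sup>2 \<le> expectation (\<lambda>x. (f x)\<^sup>2)"
  using variance_positive[of f] variance_eq[OF assms] by simp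

section \<open>Unbounded functions and geometric decay\<close>

context markov_tree
begin

lemma mean_child_meas:
  assumes [measurable]: "h \<in> borel_measurable S"
  shows "mean_child P h \<in> borel_measurable S"
proof -
  have "(\<lambda>x. \<integral>p. h (fst p) \<partial>P x) \<in> borel_measurable S" "(\<lambda>x. \<integral>p. h (snd p) \<partial>P x) \<in> borel_measurable S"
    using kernel_integral_meas[of "\<lambda>t. h (fst (snd t))"] kernel_integral_meas[of "\<lambda>t. h (snd (snd t))"] by simp_all
  then show ?thesis unfolding mean_child_def[abs_def] by simp
qed

text \<open>Intended for \<open>h'\<close> a truncation of \<open>h\<close>: domination by
  \<open>h\<close> supplies the integrals. The second inequality is Jensen for \<open>P x\<close>
  followed by convexity of the square over the two children.\<close>

lemma mean_child_power2_le:
  assumes h: "h \<in> F" and h': "h' \<in> borel_measurable S" and le: "\<And>y. \<bar>h' y\<bar> \<le> \<bar>h y\<bar>" and x: "x \<in> space S"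
  shows "mean_child P (\<lambda>y. (h' y)\<^sup>2) x \<le> mean_child P (\<lambda>y. (h y)\<^sup>2) x"
    and "(mean_child P h' x)\<^sup>2 \<le> mean_child P (\<lambda>y. (h' y)\<^sup>2) x"
proof -
  interpret P: prob_space "P x" using prob_P[OF x] .
  have le2: "(h' y)\<^sup>2 \<le> (h y)\<^sup>2" for y using le[of y] by (simp flip: abs_le_square_iff)
  have [measurable]: "(\<lambda>p. h' (fst p)) \<in> borel_measurable (P x)" "(\<lambda>p. h' (snd p)) \<in> borel_measurable (P x)"
    using h' by (simp_all add: meas_P[OF x])
  have 1: "integrable (P x) (\<lambda>p. h' (fst p))" "integrable (P x) (\<lambda>p. h' (snd p))"
    by (rule Bochner_Integration.integrable_bound[OF F_children_integrable(1)[OF h x]]; simp add: le)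
      (rule Bochner_Integration.integrable_bound[OF F_children_integrable(2)[OF h x]]; simp add: le)
  note F2 = F_children_integrable[OF F_power2[OF h] x]
  have 2: "integrable (P x) (\<lambda>p. (h' (fst p))\<^sup>2)" "integrable (P x) (\<lambda>p. (h' (snd p))\<^sup>2)"
    by (rule Bochner_Integration.integrable_bound[OF F2(1)]; simp add: le2)
      (rule Bochner_Integration.integrable_bound[OF F2(2)]; simp add: le2)
  show "mean_child P (\<lambda>y. (h' y)\<^sup>2) x \<le> mean_child P (\<lambda>y. (h y)\<^sup>2) x"
    unfolding mean_child_def
    using integral_mono[OF 2(1) F2(1) le2] integral_mono[OF 2(2) F2(2) le2] by simp
  show "(mean_child P h' x)\<^sup>2 \<le> mean_child P (\<lambda>y. (h' y)\<^sup>2) x"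
    unfolding mean_child_def
    using power2_half_sum_le[of "\<integral>p. h' (fst p) \<partial>P x" "\<integral>p. h' (snd p) \<partial>P x"]
      P.expectation_power2_le[OF 1(1) 2(1)] P.expectation_power2_le[OF 1(2) 2(2)]
    by simp
qed

text \<open>Cauchy-Schwarz over the 2^k vertices.\<close>

lemma level_sum_power2_le: "(level_sum X k h \<omega>)\<^sup>2 \<le> 2 ^ k * level_sum X k (\<lambda>x. (h x)\<^sup>2) \<omega>"
  unfolding level_sum_def using sum_squared_le_sum_of_squares[of "\<lambda>u. h (X u \<omega>)" "generation k"]
  by (simp add: card_generation mult.commute)

lemma level_sum_power2_integrable:
  assumes "h \<in> F"
  shows "integrable \<Omega> (\<lambda>\<omega>. (level_sum X k h \<omega>)\<^sup>2)"
proof (rule Bochner_Integration.integrable_bound)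
  note level_sum_meas[OF F_meas[OF assms], measurable]
  show "integrable \<Omega> (\<lambda>\<omega>. 2 ^ k * level_sum X k (\<lambda>x. (h x)\<^sup>2) \<omega>)"
    using level_sum_integrable[OF F_power2[OF assms]] by simp
  show "(\<lambda>\<omega>. (level_sum X k h \<omega>)\<^sup>2) \<in> borel_measurable \<Omega>" by measurable
  show "AE \<omega> in \<Omega>. norm ((level_sum X k h \<omega>)\<^sup>2) \<le> norm (2 ^ k * level_sum X k (\<lambda>x. (h x)\<^sup>2) \<omega>)"
    by (auto intro!: AE_I2 order_trans[OF level_sum_power2_le abs_ge_self])
qed

text \<open>Truncation reduces this to the bounded case. Both squared sums converge by dominated
  convergence: Cauchy-Schwarz provides dominating functions that are integrable because squares of
  elements of \<open>F\<close> lie in \<open>F\<close>. The remaining term is simply increased to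
  its untruncated value.\<close>

lemma second_moment:
  assumes h: "h \<in> F"
  shows "expectation (\<lambda>\<omega>. (level_sum X (Suc k) h \<omega>)\<^sup>2) \<le>
    4 * expectation (\<lambda>\<omega>. (level_sum X k (mean_child P h) \<omega>)\<^sup>2) +
    4 * expectation (level_sum X k (mean_child P (\<lambda>x. (h x)\<^sup>2)))"
proof -
  define H where "H n x = truncate n (h x)" for n x
  have hm [measurable]: "h \<in> borel_measurable S" by (rule F_meas[OF h])
  have H [measurable]: "H n \<in> borel_measurable S" for n
    unfolding H_def[abs_def] by measurable
  note level_sum_meas[measurable] mean_child_meas[measurable]
  have HC: "\<bar>H n x\<bar> \<le> real n" and Hh: "\<bar>H n x\<bar> \<le> \<bar>h x\<bar>" for n x
    unfolding H_def by (rule abs_truncate_le)+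
  have Hlim: "(\<lambda>n. H n x) \<longlonglongrightarrow> h x" for x
    unfolding H_def by (rule tendsto_truncate)
  have Hlim': "(\<lambda>n. mean_child P (H n) x) \<longlonglongrightarrow> mean_child P h x" if x: "x \<in> space S" for x
    unfolding mean_child_def
  proof (intro tendsto_divide tendsto_add tendsto_const)
    note int = F_children_integrable[OF h x]
    have [measurable]: "(\<lambda>p. h (fst p)) \<in> borel_measurable (P x)" "(\<lambda>p. h (snd p)) \<in> borel_measurable (P x)"
      "(\<lambda>p. H n (fst p)) \<in> borel_measurable (P x)" "(\<lambda>p. H n (snd p)) \<in> borel_measurable (P x)" for n
      by (simp_all add: meas_P[OF x])
    show "(\<lambda>n. \<integral>p. H n (fst p) \<partial>P x) \<longlonglongrightarrow> (\<integral>p. h (fst p) \<partial>P x)"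
      by (rule integral_dominated_convergence[where w="\<lambda>p. \<bar>h (fst p)\<bar>"])
        (use int Hlim Hh in auto)
    show "(\<lambda>n. \<integral>p. H n (snd p) \<partial>P x) \<longlonglongrightarrow> (\<integral>p. h (snd p) \<partial>P x)"
      by (rule integral_dominated_convergence[where w="\<lambda>p. \<bar>h (snd p)\<bar>"])
        (use int Hlim Hh in auto)
  qed simp
  have lim1: "(\<lambda>n. expectation (\<lambda>\<omega>. (level_sum X (Suc k) (H n) \<omega>)\<^sup>2)) \<longlonglongrightarrow>
      expectation (\<lambda>\<omega>. (level_sum X (Suc k) h \<omega>)\<^sup>2)"
  proof (rule integral_dominated_convergence)
    show "integrable \<Omega> (\<lambda>\<omega>. 2 ^ Suc k * level_sum X (Suc k) (\<lambda>x. (h x)\<^sup>2) \<omega>)"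
      using level_sum_integrable[OF F_power2[OF h]] by simp
    show "AE \<omega> in \<Omega>. norm ((level_sum X (Suc k) (H n) \<omega>)\<^sup>2) \<le> 2 ^ Suc k * level_sum X (Suc k) (\<lambda>x. (h x)\<^sup>2) \<omega>" for n
    proof (rule AE_I2)
      fix \<omega> assume "\<omega> \<in> space \<Omega>"
      then have "level_sum X (Suc k) (\<lambda>x. (H n x)\<^sup>2) \<omega> \<le> level_sum X (Suc k) (\<lambda>x. (h x)\<^sup>2) \<omega>"
        by (rule level_sum_mono) (simp add: Hh flip: abs_le_square_iff)
      then have "2 ^ Suc k * level_sum X (Suc k) (\<lambda>x. (H n x)\<^sup>2) \<omega> \<le> 2 ^ Suc k * level_sum X (Suc k) (\<lambda>x. (h x)\<^sup>2) \<omega>"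
        by (rule mult_left_mono) simp
      then show "norm ((level_sum X (Suc k) (H n) \<omega>)\<^sup>2) \<le> 2 ^ Suc k * level_sum X (Suc k) (\<lambda>x. (h x)\<^sup>2) \<omega>"
        using order_trans[OF level_sum_power2_le] by (simp only: real_norm_def abs_power2)
    qed
    show "AE \<omega> in \<Omega>. (\<lambda>n. (level_sum X (Suc k) (H n) \<omega>)\<^sup>2) \<longlonglongrightarrow> (level_sum X (Suc k) h \<omega>)\<^sup>2"
      unfolding level_sum_def by (intro AE_I2 tendsto_power tendsto_sum Hlim)
  qed measurable
  have lim2: "(\<lambda>n. expectation (\<lambda>\<omega>. (level_sum X k (mean_child P (H n)) \<omega>)\<^sup>2)) \<longlonglongrightarrow>
      expectation (\<lambda>\<omega>. (level_sum X k (mean_child P h) \<omega>)\<^sup>2)"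
  \<comment> \<open>Jensen is used here as well: the squared child mean of \<open>H n\<close> is at
    most the child mean of the square of \<open>h\<close>.\<close>
  proof (rule integral_dominated_convergence)
    show "integrable \<Omega> (\<lambda>\<omega>. 2 ^ k * level_sum X k (mean_child P (\<lambda>x. (h x)\<^sup>2)) \<omega>)"
      using level_sum_integrable[OF mean_child_F[OF F_power2[OF h]]] by simp
    show "AE \<omega> in \<Omega>. norm ((level_sum X k (mean_child P (H n)) \<omega>)\<^sup>2) \<le>
        2 ^ k * level_sum X k (mean_child P (\<lambda>x. (h x)\<^sup>2)) \<omega>" for n
    proof (rule AE_I2)
      fix \<omega> assume "\<omega> \<in> space \<Omega>"
      then have "level_sum X k (\<lambda>x. (mean_child P (H n) x)\<^sup>2) \<omega> \<le> level_sum X k (mean_child P (\<lambda>x. (h x)\<^sup>2)) \<omega>"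
        by (rule level_sum_mono) (rule order_trans[OF mean_child_power2_le(2,1)[OF h H Hh]])
      then have "2 ^ k * level_sum X k (\<lambda>x. (mean_child P (H n) x)\<^sup>2) \<omega> \<le>
          2 ^ k * level_sum X k (mean_child P (\<lambda>x. (h x)\<^sup>2)) \<omega>"
        by (rule mult_left_mono) simp
      then show "norm ((level_sum X k (mean_child P (H n)) \<omega>)\<^sup>2) \<le>
          2 ^ k * level_sum X k (mean_child P (\<lambda>x. (h x)\<^sup>2)) \<omega>"
        using order_trans[OF level_sum_power2_le] by (simp only: real_norm_def abs_power2)
    qed
    show "AE \<omega> in \<Omega>. (\<lambda>n. (level_sum X k (mean_child P (H n)) \<omega>)\<^sup>2) \<longlonglongrightarrow> (level_sum X k (mean_child P h) \<omega>)\<^sup>2"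
      unfolding level_sum_def by (intro AE_I2 tendsto_power tendsto_sum Hlim' X_space)
  qed measurable
  have le: "expectation (\<lambda>\<omega>. (level_sum X (Suc k) (H n) \<omega>)\<^sup>2) \<le>
    4 * expectation (\<lambda>\<omega>. (level_sum X k (mean_child P (H n)) \<omega>)\<^sup>2) +
    4 * expectation (level_sum X k (mean_child P (\<lambda>x. (h x)\<^sup>2)))" for n
  proof -
    have "expectation (level_sum X k (mean_child P (\<lambda>x. (H n x)\<^sup>2))) \<le>
        expectation (level_sum X k (mean_child P (\<lambda>x. (h x)\<^sup>2)))"
    \<comment> \<open>Only the larger side has to be integrable; the truncated function is not known
      to lie in \<open>F\<close>.\<close>
    proof (rule integral_mono')
      show "integrable \<Omega> (level_sum X k (mean_child P (\<lambda>x. (h x)\<^sup>2)))"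
        by (intro level_sum_integrable mean_child_F F_power2 h)
      show "level_sum X k (mean_child P (\<lambda>x. (H n x)\<^sup>2)) \<omega> \<le> level_sum X k (mean_child P (\<lambda>x. (h x)\<^sup>2)) \<omega>"
        if "\<omega> \<in> space \<Omega>" for \<omega>
        using that by (rule level_sum_mono) (rule mean_child_power2_le(1)[OF h H Hh])
    qed (auto simp: level_sum_def intro!: sum_nonneg mean_child_nonneg)
    then show ?thesis
      using second_moment_bounded[OF H HC, of k n] by simp
  qed
  show ?thesis
    by (rule LIMSEQ_le[OF lim1 tendsto_add[OF tendsto_mult[OF tendsto_const lim2] tendsto_const]])
      (use le in auto)
qed

text \<open>The second moment inequality is iterated. After division by 4^k, one step passes from h
  to its child mean, whose bound has c \<alpha> in place of c, and adds a term of order c^2 / 2^k.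
  Hence the rate must exceed both \<alpha>^2 and 1/2, and the induction needs a general c.\<close>

lemma level_sum_power2_decay:
  assumes g: "g \<in> F" and r: "\<alpha>\<^sup>2 < r" "1 / 2 < r" "r < 1"
  shows "\<exists>C\<ge>0. \<forall>k. \<forall>c\<ge>0. \<forall>h\<in>F. (\<forall>m. \<forall>x\<in>space S. \<bar>(mean_child P ^^ m) h x\<bar> \<le> c * \<alpha> ^ m * g x) \<longrightarrow>
    expectation (\<lambda>\<omega>. (level_sum X k h \<omega>)\<^sup>2) \<le> 4 ^ k * (c\<^sup>2 * (C * r ^ k))"
proof -
  obtain B where B: "0 \<le> B" and EB: "\<And>k. expectation (level_sum X k (\<lambda>x. (g x)\<^sup>2)) \<le> 2 ^ k * B"
    using expectation_level_sum_bounded[OF F_power2[OF g]] by blast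
  \<comment> \<open>Chosen to solve D r = \<alpha>^2 D + 1, the identity that closes the induction
    step; D >= 1 covers generation 0.\<close>
  define D where "D = 1 / (r - \<alpha>\<^sup>2)"
  have D: "1 \<le> D" and Dr: "D * r = \<alpha>\<^sup>2 * D + 1"
    using r add_increasing2[OF zero_le_power2[of \<alpha>] less_imp_le[OF r(3)]] by (simp_all add: D_def field_simps)
  have E2: "expectation (level_sum X k (\<lambda>x. (h x)\<^sup>2)) \<le> c\<^sup>2 * (2 ^ k * B)"
    if h: "h \<in> F" and bound: "\<And>x. x \<in> space S \<Longrightarrow> \<bar>h x\<bar> \<le> c * g x" for h k c
  proof -
    have "expectation (level_sum X k (\<lambda>x. (h x)\<^sup>2)) \<le> expectation (level_sum X k (\<lambda>x. c\<^sup>2 * (g x)\<^sup>2))"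
    proof (intro integral_mono level_sum_integrable F_power2 F_scale h g level_sum_mono)
      fix x assume "x \<in> space S"
      then show "(h x)\<^sup>2 \<le> c\<^sup>2 * (g x)\<^sup>2"
        using power_mono[OF bound, of x 2] by (simp add: power_mult_distrib)
    qed
    also have "\<dots> = c\<^sup>2 * expectation (level_sum X k (\<lambda>x. (g x)\<^sup>2))"
      by (simp add: level_sum_scale[abs_def])
    also have "\<dots> \<le> c\<^sup>2 * (2 ^ k * B)"
      by (intro mult_left_mono EB) simp
    finally show ?thesis .
  qed
  have main: "expectation (\<lambda>\<omega>. (level_sum X k h \<omega>)\<^sup>2) \<le> 4 ^ k * (c\<^sup>2 * (B * D * r ^ k))"
    if "h \<in> F" "0 \<le> c" "\<And>m x. x \<in> space S \<Longrightarrow> \<bar>(mean_child P ^^ m) h x\<bar> \<le> c * \<alpha> ^ m * g x" for k c h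
    using that
  proof (induction k arbitrary: c h)
    case 0
    have "expectation (\<lambda>\<omega>. (level_sum X 0 h \<omega>)\<^sup>2) = expectation (level_sum X 0 (\<lambda>x. (h x)\<^sup>2))"
      by (simp add: level_sum_def[abs_def] generation_0)
    also have "\<dots> \<le> c\<^sup>2 * (2 ^ 0 * B)"
      using E2[OF 0(1), of c 0] 0(3)[of _ 0] by simp
    also have "\<dots> \<le> c\<^sup>2 * (B * D)"
      using mult_left_mono[OF D B] by (intro mult_left_mono) auto
    finally show ?case by simp
  next
    case (Suc k)
    \<comment> \<open>Shifting m by one moves a factor \<alpha> into the constant.\<close>
    have "\<bar>(mean_child P ^^ m) (mean_child P h) x\<bar> \<le> (c * \<alpha>) * \<alpha> ^ m * g x" if "x \<in> space S" for m x
      using Suc.prems(3)[OF that, of "Suc m"] by (simp add: funpow_swap1 mult_ac)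
    then have IH: "expectation (\<lambda>\<omega>. (level_sum X k (mean_child P h) \<omega>)\<^sup>2) \<le> 4 ^ k * ((c * \<alpha>)\<^sup>2 * (B * D * r ^ k))"
      using Suc.prems \<alpha> by (intro Suc.IH mean_child_F) auto
    \<comment> \<open>Twice the level sum of child means at k has the same expectation as the level
      sum at k + 1, so \<open>E2\<close> applies there with h itself.\<close>
    have "2 * expectation (level_sum X k (mean_child P (\<lambda>x. (h x)\<^sup>2))) \<le> c\<^sup>2 * (2 ^ Suc k * B)"
      using E2[OF Suc.prems(1), of c "Suc k"] Suc.prems(3)[of _ 0]
      by (simp add: expectation_level_sum_Suc F_power2 Suc.prems(1))
    moreover have pow: "(4 :: real) ^ k * (c\<^sup>2 * B * (1 / 2) ^ k) = c\<^sup>2 * B * 2 ^ k"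
    proof -
      have "(4 :: real) ^ k * (1 / 2) ^ k = 2 ^ k" by (simp flip: power_mult_distrib)
      then show ?thesis by (metis mult.left_commute)
    qed
    ultimately have E: "expectation (level_sum X k (mean_child P (\<lambda>x. (h x)\<^sup>2))) \<le> 4 ^ k * (c\<^sup>2 * B * (1 / 2) ^ k)"
      unfolding pow by (simp add: mult_ac)
    have "expectation (\<lambda>\<omega>. (level_sum X (Suc k) h \<omega>)\<^sup>2) \<le>
      4 * (4 ^ k * ((c * \<alpha>)\<^sup>2 * (B * D * r ^ k))) + 4 * (4 ^ k * (c\<^sup>2 * B * (1 / 2) ^ k))"
      using second_moment[OF Suc.prems(1), of k] IH E by linarith
    also have "\<dots> \<le> 4 * (4 ^ k * ((c * \<alpha>)\<^sup>2 * (B * D * r ^ k))) + 4 * (4 ^ k * (c\<^sup>2 * B * r ^ k))"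
      using r B by (intro add_left_mono mult_left_mono power_mono) auto
    also have "\<dots> = 4 ^ Suc k * (c\<^sup>2 * (B * (\<alpha>\<^sup>2 * D + 1) * r ^ k))"
      by (simp add: power_mult_distrib algebra_simps)
    also have "\<dots> = 4 ^ Suc k * (c\<^sup>2 * (B * D * r ^ Suc k))"
      by (simp flip: Dr)
    finally show ?case .
  qed
  then show ?thesis
    using B D by (intro exI[of _ "B * D"]) auto
qed

text \<open>Passing from second to first absolute moments takes square roots of the constant and of
  the rate. Both are uniform in h, as needed for the functions \<open>h (n - k)\<close>, which vary
  with n.\<close>

lemma level_sum_decay:
  assumes g: "g \<in> F"
  shows "\<exists>C \<rho>. 0 \<le> C \<and> 1 / 2 < \<rho> \<and> \<rho> < 1 \<and>
    (\<forall>h\<in>F. (\<forall>m. \<forall>x\<in>space S. \<bar>(mean_child P ^^ m) h x\<bar> \<le> \<alpha> ^ m * g x) \<longrightarrow>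
      (\<forall>k. expectation (\<lambda>\<omega>. \<bar>level_sum X k h \<omega>\<bar>) \<le> C * (2 * \<rho>) ^ k))"
proof -
  \<comment> \<open>Halfway between max (\<alpha>^2) (1/2) and 1, which is possible for every
    \<alpha> < 1.\<close>
  define r where "r = (1 + max (\<alpha>\<^sup>2) (1 / 2)) / 2"
  have "\<alpha>\<^sup>2 < 1" using \<alpha> by (simp add: power_less_one_iff)
  then have r: "\<alpha>\<^sup>2 < r" "1 / 2 < r" "r < 1"
    by (auto simp: r_def max_def)
  obtain C where C: "0 \<le> C" and
    sq: "\<And>k h. h \<in> F \<Longrightarrow> (\<And>m x. x \<in> space S \<Longrightarrow> \<bar>(mean_child P ^^ m) h x\<bar> \<le> 1 * \<alpha> ^ m * g x) \<Longrightarrow>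
    expectation (\<lambda>\<omega>. (level_sum X k h \<omega>)\<^sup>2) \<le> 4 ^ k * (1\<^sup>2 * (C * r ^ k))"
    using level_sum_power2_decay[OF g r] zero_le_one by blast
  have "1 / 2 < sqrt r"
    using r by (intro real_less_rsqrt) (simp add: power2_eq_square)
  moreover have "sqrt r < 1" using r by simp
  moreover have "expectation (\<lambda>\<omega>. \<bar>level_sum X k h \<omega>\<bar>) \<le> sqrt C * (2 * sqrt r) ^ k"
    if h: "h \<in> F" and "\<forall>m. \<forall>x\<in>space S. \<bar>(mean_child P ^^ m) h x\<bar> \<le> \<alpha> ^ m * g x" for h k
  proof (rule power2_le_imp_le)
    have "(expectation (\<lambda>\<omega>. \<bar>level_sum X k h \<omega>\<bar>))\<^sup>2 \<le> expectation (\<lambda>\<omega>. \<bar>level_sum X k h \<omega>\<bar>\<^sup>2)"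
      using level_sum_integrable[OF h] level_sum_power2_integrable[OF h]
      by (intro expectation_power2_le) auto
    also have "\<dots> \<le> 4 ^ k * (C * r ^ k)"
      using sq[OF h, of k] that(2) by simp
    also have "\<dots> = (sqrt C * (2 * sqrt r) ^ k)\<^sup>2"
    proof -
      have "((2 * sqrt r) ^ k)\<^sup>2 = ((2 * sqrt r)\<^sup>2) ^ k"
        by (metis power_mult mult.commute)
      also have "\<dots> = 4 ^ k * r ^ k" using r by (simp add: power_mult_distrib)
      finally show ?thesis using C by (simp add: power_mult_distrib[of "sqrt C"])
    qed
    finally show "(expectation (\<lambda>\<omega>. \<bar>level_sum X k h \<omega>\<bar>))\<^sup>2 \<le> (sqrt C * (2 * sqrt r) ^ k)\<^sup>2" .
  qed (use C r in simp)
  ultimately show ?thesis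
    using C by (intro exI[of _ "sqrt C"] exI[of _ "sqrt r"]) auto
qed

end

section \<open>Characteristic functions\<close>

text \<open>The chain exp (-a) <= 1 / (1 + a) <= 1 - a + a^2 requires no smallness of a; this
  matters because \<open>h l x\<close> need not be bounded in x.\<close>

lemma exp_minus_approx:
  fixes a :: real
  assumes "0 \<le> a"
  shows "\<bar>exp (- a) - (1 - a)\<bar> \<le> a\<^sup>2"
proof -
  have "exp (- a) \<le> 1 / (1 + a)"
    using assms exp_ge_add_one_self[of a] by (simp add: exp_minus field_simps)
  also have "\<dots> \<le> 1 - a + a\<^sup>2"
    using assms by (simp add: field_simps power2_eq_square)
  finally show ?thesis
    using exp_ge_add_one_self[of "- a"] by simp
qed

text \<open>Lets an L1 bound on the random exponent pass to the exponential factor.\<close>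

lemma exp_minus_diff_le:
  fixes a b :: real
  assumes "0 \<le> a" "0 \<le> b"
  shows "\<bar>exp (- a) - exp (- b)\<bar> \<le> \<bar>a - b\<bar>"
proof -
  have *: "exp (- a) - exp (- b) \<le> b - a" if "a \<le> b" "0 \<le> a" for a b :: real
  proof -
    have "exp (- a) - exp (- b) = exp (- a) * (1 - exp (- (b - a)))"
      by (simp add: right_diff_distrib flip: exp_add)
    also have "\<dots> \<le> 1 * (b - a)"
    proof (rule mult_mono)
      show "1 - exp (- (b - a)) \<le> b - a"
        using exp_ge_add_one_self[of "- (b - a)"] by linarith
    qed (use that in auto)
    finally show ?thesis by simp
  qed
  show ?thesis
    using *[of a b] *[of b a] assms by (cases "a \<le> b") auto
qed

lemma char_gaussian_law:
  assumes "0 \<le> v"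
  shows "char (gaussian_law 0 v) t = complex_of_real (exp (- (t\<^sup>2 * v / 2)))"
proof (cases "v = 0")
  case True
  then show ?thesis by (simp add: gaussian_law_def char_def integral_return)
next
  case False
  with assms have v: "0 < sqrt v" by simp
  interpret N: prob_space std_normal_distribution by (rule prob_space_normal_density) simp
  have "distributed std_normal_distribution lborel (\<lambda>x. x) std_normal_density"
    by (simp add: distributed_def distr_id2)
  \<comment> \<open>The terms with 0 and 1 match the affine rule for normal densities; scaling by
    sqrt v reduces the claim to the standard normal law.\<close>
  then have "distributed std_normal_distribution lborel (\<lambda>x. 0 + sqrt v * x) (normal_density (0 + sqrt v * 0) (\<bar>sqrt v\<bar> * 1))"
    using v by (intro N.normal_density_affine) auto
  then have "gaussian_law 0 v = distr std_normal_distribution lborel (\<lambda>x. sqrt v * x)"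
    using False v by (simp add: gaussian_law_def distributed_def)
  then have "gaussian_law 0 v = distr std_normal_distribution borel (\<lambda>x. sqrt v * x)"
    by (simp cong: distr_cong)
  then have "char (gaussian_law 0 v) t = char std_normal_distribution (t * sqrt v)"
    by (simp add: char_def integral_distr mult_ac)
  then show ?thesis
    using assms by (simp add: char_std_normal_distribution power_mult_distrib)
qed

lemma real_distribution_gaussian_law:
  assumes "0 \<le> v"
  shows "real_distribution (gaussian_law 0 v)"
proof -
  have "prob_space (gaussian_law 0 v)"
    using assms unfolding gaussian_law_def
    by (auto intro!: prob_space_return prob_space_normal_density)
  moreover have "sets (gaussian_law 0 v) = sets borel" "space (gaussian_law 0 v) = UNIV"
    by (simp_all add: gaussian_law_def)
  ultimately show ?thesis
    by (simp add: real_distribution_def real_distribution_axioms_def)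
qed

section \<open>Gaussian approximation, one generation at a time\<close>

locale centred_functional = markov_tree \<Omega> S \<nu> \<mu> P X F \<alpha>
  for \<Omega> :: "'w measure" and S :: "'s measure" and \<nu> \<mu> P X F \<alpha> +
  fixes f :: "nat \<Rightarrow> 's \<times> 's \<times> 's \<Rightarrow> real" and g :: "'s \<Rightarrow> real"
  assumes f_meas [measurable]: "f l \<in> borel_measurable (S \<Otimes>\<^sub>M S \<Otimes>\<^sub>M S)"
    and f_integrable: "well_defined3 S P (f l)"
    and f2_integrable: "well_defined3 S P (\<lambda>t. f l t ^ 2)"
    and f4_integrable: "well_defined3 S P (\<lambda>t. f l t ^ 4)"
    and g: "g \<in> F"
    and f2_bounds: "uniform_ergodic_bounds S (induced_kernel S P) F \<mu> \<alpha> (\<lambda>l. kernel_op3 P (\<lambda>t. f l t ^ 2)) g"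
    and f4_bounds: "uniform_ergodic_bounds S (induced_kernel S P) F \<mu> \<alpha> (\<lambda>l. kernel_op3 P (\<lambda>t. f l t ^ 4)) g"
    and f_centred: "x \<in> space S \<Longrightarrow> kernel_op3 P (f l) x = 0"
begin

definition h :: "nat \<Rightarrow> 's \<Rightarrow> real" where
  "h l = kernel_op3 P (\<lambda>t. f l t ^ 2)"

definition \<sigma> :: "nat \<Rightarrow> real" where
  "\<sigma> l = (\<integral>x. h l x \<partial>\<mu>)"

lemma h_F: "h l \<in> F"
  using f2_bounds by (simp add: uniform_ergodic_bounds_def h_def)

lemma kernel_pow_0_F: "k \<in> F \<Longrightarrow> x \<in> space S \<Longrightarrow> kernel_op (kernel_pow S (induced_kernel S P) 0) k x = k x"
  using kernel_pow_F[of k x 0] by simp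

lemma h_le: "x \<in> space S \<Longrightarrow> h l x \<le> g x"
  using f2_bounds kernel_pow_0_F[OF h_F, of x l] unfolding uniform_ergodic_bounds_def h_def
  by (metis abs_le_D1)

lemma f4_le: "x \<in> space S \<Longrightarrow> kernel_op3 P (\<lambda>t. f l t ^ 4) x \<le> g x"
  using f4_bounds kernel_pow_0_F[of "kernel_op3 P (\<lambda>t. f l t ^ 4)" x] unfolding uniform_ergodic_bounds_def
  by (metis abs_le_D1)

lemma h_nonneg: "0 \<le> h l x"
  by (simp add: h_def kernel_op3_eq)

lemma g_nonneg: "x \<in> space S \<Longrightarrow> 0 \<le> g x"
  using h_nonneg[of 0 x] h_le[of x 0] by simp

lemma \<sigma>_nonneg: "0 \<le> \<sigma> l" and \<sigma>_le: "\<sigma> l \<le> (\<integral>x. g x \<partial>\<mu>)"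
  unfolding \<sigma>_def
  by (auto intro!: Bochner_Integration.integral_nonneg h_nonneg integral_mono F_integrable_\<mu> h_F g h_le simp: space_\<mu>)

text \<open>The iterated kernels are probability measures and fix constants, so centring before or
  after applying them is the same. The bound \<open>g\<close> serves all l.\<close>

lemma h_ergodic:
  assumes x: "x \<in> space S"
  shows "\<bar>(mean_child P ^^ m) (\<lambda>y. h l y - \<sigma> l) x\<bar> \<le> \<alpha> ^ m * g x"
proof -
  let ?K = "kernel_pow S (induced_kernel S P) m x"
  interpret K: prob_space ?K
    using measurable_space[OF kernel_pow_measurable x] by (simp add: space_prob_algebra)
  have "(mean_child P ^^ m) (\<lambda>y. h l y - \<sigma> l) x = (\<integral>y. h l y - \<sigma> l \<partial>?K)"
    using kernel_pow_F[OF F_diff[OF h_F[of l] F_const[of "\<sigma> l"]] x, of m] by (simp add: kernel_op_def)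
  also have "\<dots> = kernel_op (kernel_pow S (induced_kernel S P) m) (h l) x - \<sigma> l"
    using kernel_pow_F[OF h_F[of l] x, of m] by (simp add: kernel_op_def K.prob_space)
  finally show ?thesis
    using f2_bounds x unfolding uniform_ergodic_bounds_def \<sigma>_def h_def by simp
qed

lemma section_integrable:
  assumes x: "x \<in> space S"
  shows "integrable (P x) (\<lambda>p. f l (x, p))" "integrable (P x) (\<lambda>p. (f l (x, p))\<^sup>2)"
    "integrable (P x) (\<lambda>p. f l (x, p) ^ 4)"
  using f_integrable[of l] f2_integrable[of l] f4_integrable[of l] x
  by (simp_all add: well_defined3_def case_prod_unfold)

text \<open>Second order Taylor expansion: the first moment vanishes and the second is
  \<open>h l x\<close>, which leaves 1 - s^2 h / 2 and a cubic remainder. Exchanging this for the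
  exponential costs a term in h^2. Both errors are controlled by second and fourth moments, hence by
  \<open>g\<close>.\<close>

lemma char_section_approx:
  assumes x: "x \<in> space S"
  shows "norm ((\<integral>p. iexp (s * f l (x, p)) \<partial>P x) - complex_of_real (exp (- (s\<^sup>2 * h l x / 2))))
    \<le> (\<bar>s\<bar> ^ 3 + s ^ 4) * g x"
proof -
  interpret P: prob_space "P x" using prob_P[OF x] .
  define Y where "Y p = f l (x, p)" for p
  have Y [measurable]: "Y \<in> borel_measurable (P x)"
    unfolding Y_def[abs_def] by (rule section_meas[OF x f_meas])
  have int: "integrable (P x) Y" "integrable (P x) (\<lambda>p. (Y p)\<^sup>2)" "integrable (P x) (\<lambda>p. Y p ^ 4)"
    using section_integrable[OF x, of l] by (simp_all add: Y_def[abs_def])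
  have mean: "P.expectation Y = 0" "P.expectation (\<lambda>p. (Y p)\<^sup>2) = h l x"
    and m4: "P.expectation (\<lambda>p. Y p ^ 4) \<le> g x"
    using f_centred[OF x, of l] f4_le[OF x, of l] by (simp_all add: Y_def[abs_def] h_def kernel_op3_eq)
  \<comment> \<open>The second order Taylor polynomial of \<open>iexp (s * Y p)\<close>.\<close>
  define T where "T p = 1 + \<i> * complex_of_real (s * Y p) - complex_of_real (s\<^sup>2 * (Y p)\<^sup>2 / 2)" for p
  have intT: "integrable (P x) T"
    unfolding T_def[abs_def] using int
    by (intro Bochner_Integration.integrable_diff Bochner_Integration.integrable_add integrable_mult_right integrable_of_real) auto
  have "P.expectation T = 1 + \<i> * complex_of_real (P.expectation (\<lambda>p. s * Y p)) -
      complex_of_real (P.expectation (\<lambda>p. s\<^sup>2 * (Y p)\<^sup>2 / 2))"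
    unfolding T_def[abs_def] using int
    by (subst Bochner_Integration.integral_diff Bochner_Integration.integral_add;
        (auto simp: P.prob_space simp del: of_real_mult of_real_divide of_real_power)?)+
  then have ET: "P.expectation T = complex_of_real (1 - s\<^sup>2 * h l x / 2)"
    using int by (simp add: mean)
  have inte: "integrable (P x) (\<lambda>p. iexp (s * Y p))"
    by (rule P.integrable_const_bound[where B=1]) auto
  \<comment> \<open>The available bounds concern second and fourth moments, so the third absolute
    moment is interpolated between them.\<close>
  have cube: "\<bar>y\<bar> ^ 3 \<le> (y\<^sup>2 + y ^ 4) / 2" for y :: real
  proof -
    have "0 \<le> y\<^sup>2 * (\<bar>y\<bar> - 1)\<^sup>2" by simp
    also have "\<dots> = y\<^sup>2 + y ^ 4 - 2 * \<bar>y\<bar> ^ 3"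
      by (simp add: power2_diff algebra_simps power2_eq_square power3_eq_cube power4_eq_xxxx)
    finally show ?thesis by simp
  qed
  have point: "norm (iexp (s * Y p) - T p) \<le> \<bar>s\<bar> ^ 3 / 12 * ((Y p)\<^sup>2 + Y p ^ 4)" for p
  proof -
    have "norm (iexp (s * Y p) - T p) \<le> \<bar>s * Y p\<bar> ^ 3 / 6"
      using iexp_approx1[of "s * Y p" 2]
      by (simp add: T_def eval_nat_numeral algebra_simps)
    also have "\<dots> = \<bar>s\<bar> ^ 3 / 6 * \<bar>Y p\<bar> ^ 3"
      by (simp add: abs_mult power_mult_distrib)
    also have "\<dots> \<le> \<bar>s\<bar> ^ 3 / 6 * (((Y p)\<^sup>2 + Y p ^ 4) / 2)"
      by (intro mult_left_mono cube) simp
    finally show ?thesis by simp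
  qed
  have "norm (P.expectation (\<lambda>p. iexp (s * Y p)) - P.expectation T) = norm (P.expectation (\<lambda>p. iexp (s * Y p) - T p))"
    using inte intT by simp
  also have "\<dots> \<le> P.expectation (\<lambda>p. norm (iexp (s * Y p) - T p))"
    by (rule integral_norm_bound)
  also have "\<dots> \<le> P.expectation (\<lambda>p. \<bar>s\<bar> ^ 3 / 12 * ((Y p)\<^sup>2 + Y p ^ 4))"
    using inte intT int by (intro integral_mono point) auto
  also have "\<dots> = \<bar>s\<bar> ^ 3 / 12 * (h l x + P.expectation (\<lambda>p. Y p ^ 4))"
    using int by (simp add: mean)
  also have "\<dots> \<le> \<bar>s\<bar> ^ 3 / 12 * (g x + g x)"
    by (intro mult_left_mono add_mono h_le x m4) simp
  also have "\<dots> \<le> \<bar>s\<bar> ^ 3 * g x"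
    using g_nonneg[OF x] by simp
  finally have 1: "norm (P.expectation (\<lambda>p. iexp (s * Y p)) - P.expectation T) \<le> \<bar>s\<bar> ^ 3 * g x" .
  \<comment> \<open>Jensen: the squared second moment is at most the fourth moment.\<close>
  have "(h l x)\<^sup>2 \<le> P.expectation (\<lambda>p. ((Y p)\<^sup>2)\<^sup>2)"
    using P.expectation_power2_le[OF int(2)] int(3) by (simp add: mean)
  then have hg: "(h l x)\<^sup>2 \<le> g x" using m4 by simp
  have "norm (P.expectation T - complex_of_real (exp (- (s\<^sup>2 * h l x / 2)))) =
      \<bar>exp (- (s\<^sup>2 * h l x / 2)) - (1 - s\<^sup>2 * h l x / 2)\<bar>"
    unfolding ET by (subst norm_minus_commute) (simp only: norm_of_real flip: of_real_diff)
  also have "\<dots> \<le> (s\<^sup>2 * h l x / 2)\<^sup>2"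
    by (intro exp_minus_approx) (simp add: h_nonneg)
  also have "\<dots> = s ^ 4 / 4 * (h l x)\<^sup>2"
    by (simp add: power_mult_distrib power_divide)
  also have "\<dots> \<le> s ^ 4 / 4 * g x"
    by (intro mult_left_mono hg) simp
  also have "\<dots> \<le> s ^ 4 * g x"
    using g_nonneg[OF x] by simp
  finally have 2: "norm (P.expectation T - complex_of_real (exp (- (s\<^sup>2 * h l x / 2)))) \<le> s ^ 4 * g x" .
  show ?thesis
    using norm_triangle_le[OF add_mono[OF 1 2]] by (simp add: Y_def distrib_right)
qed

text \<open>The numerator of \<open>N_root\<close>, ordered by generation k = n - l so that it grows
  along the filtration, and stopped before generation j. It is complete at j = n + 1, and up to
  there n - k is never truncated.\<close>

definition partial_sum :: "nat \<Rightarrow> nat \<Rightarrow> 'w \<Rightarrow> real" where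
  "partial_sum n j \<omega> = (\<Sum>k<j. \<Sum>u\<in>generation k. f (n - k) (triangle X u \<omega>))"

lemma partial_sum_history: "partial_sum n j \<in> borel_measurable (history \<Omega> S X j)"
  unfolding partial_sum_def[abs_def]
proof (intro borel_measurable_sum)
  fix k u assume "k \<in> {..<j}" "u \<in> generation k"
  then have "length u < j" by (simp add: generation_def)
  then show "(\<lambda>\<omega>. f (n - k) (triangle X u \<omega>)) \<in> borel_measurable (history \<Omega> S X j)"
    by (rule measurable_compose[OF triangle_history f_meas])
qed

lemma partial_sum_meas [measurable]: "partial_sum n j \<in> borel_measurable \<Omega>"
  by (rule measurable_from_subalg[OF history_subalgebra partial_sum_history])

text \<open>Conditioning on the past replaces the factors of generation j by their kernel means.
  These are exchanged for Gaussian factors, which gives the first error term, and the resulting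
  random exponent for its \<mu>-mean, which gives the second. The weight from the past has modulus 1
  and does not enlarge the errors.\<close>

lemma char_step:
  "norm (expectation (\<lambda>\<omega>. iexp (s * partial_sum n (Suc j) \<omega>)) -
      expectation (\<lambda>\<omega>. iexp (s * partial_sum n j \<omega>)) * complex_of_real (exp (- (s\<^sup>2 * (2 ^ j * \<sigma> (n - j)) / 2))))
    \<le> (\<bar>s\<bar> ^ 3 + s ^ 4) * expectation (level_sum X j g) +
      s\<^sup>2 / 2 * expectation (\<lambda>\<omega>. \<bar>level_sum X j (\<lambda>x. h (n - j) x - \<sigma> (n - j)) \<omega>\<bar>)"
proof -
  define l where "l = n - j"
  define \<phi> where "\<phi> x = (\<integral>p. iexp (s * f l (x, p)) \<partial>P x)" for x
  define c where "c = exp (- (s\<^sup>2 * (2 ^ j * \<sigma> l) / 2))"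
  define Z where "Z \<omega> = iexp (s * partial_sum n j \<omega>)" for \<omega>
  have Zm: "Z \<in> borel_measurable (history \<Omega> S X j)"
    unfolding Z_def[abs_def] using partial_sum_history by measurable
  have Z [measurable]: "Z \<in> borel_measurable \<Omega>" unfolding Z_def[abs_def] by measurable
  have Z1: "norm (Z \<omega>) = 1" for \<omega> by (simp add: Z_def)
  have im: "(\<lambda>t. iexp (s * f l t)) \<in> borel_measurable (S \<Otimes>\<^sub>M S \<Otimes>\<^sub>M S)" by measurable
  have \<phi> [measurable]: "\<phi> \<in> borel_measurable S"
    unfolding \<phi>_def[abs_def] by (rule kernel_integral_meas[OF im])
  have \<phi>1: "norm (\<phi> x) \<le> 1" if "x \<in> space S" for x
    unfolding \<phi>_def by (rule kernel_integral_bounded[OF that im]) simp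
  have step: "expectation (\<lambda>\<omega>. iexp (s * partial_sum n (Suc j) \<omega>)) =
      expectation (\<lambda>\<omega>. Z \<omega> * (\<Prod>u\<in>generation j. \<phi> (X u \<omega>)))"
  proof -
    have "iexp (s * partial_sum n (Suc j) \<omega>) = Z \<omega> * (\<Prod>u\<in>generation j. iexp (s * f l (triangle X u \<omega>)))" for \<omega>
      by (simp add: Z_def partial_sum_def l_def algebra_simps sum_distrib_left exp_add exp_sum)
    then show ?thesis
      using product_formula_complex[of "\<lambda>_ t. iexp (s * f l t)" Z j] im Zm Z1
      by (simp add: \<phi>_def)
  qed
  have hm [measurable]: "h l \<in> borel_measurable S" "g \<in> borel_measurable S" by (rule F_meas[OF h_F], rule F_meas[OF g])
  note level_sum_meas[measurable]
  let ?D = "\<lambda>\<omega>. level_sum X j (\<lambda>x. h l x - \<sigma> l) \<omega>"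
  have point: "norm ((\<Prod>u\<in>generation j. \<phi> (X u \<omega>)) - complex_of_real c)
      \<le> (\<bar>s\<bar> ^ 3 + s ^ 4) * level_sum X j g \<omega> + s\<^sup>2 / 2 * \<bar>?D \<omega>\<bar>"
    if \<omega>: "\<omega> \<in> space \<Omega>" for \<omega>
  proof -
    define e where "e u = complex_of_real (exp (- (s\<^sup>2 * h l (X u \<omega>) / 2)))" for u
    \<comment> \<open>All factors have modulus at most 1, so exchanging them one at a time bounds
      the difference of the products by the sum of the differences.\<close>
    have "norm ((\<Prod>u\<in>generation j. \<phi> (X u \<omega>)) - (\<Prod>u\<in>generation j. e u)) \<le> (\<Sum>u\<in>generation j. norm (\<phi> (X u \<omega>) - e u))"
      by (intro norm_prod_diff \<phi>1 X_space \<omega>) (simp add: e_def h_nonneg)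
    also have "\<dots> \<le> (\<Sum>u\<in>generation j. (\<bar>s\<bar> ^ 3 + s ^ 4) * g (X u \<omega>))"
      unfolding e_def \<phi>_def by (intro sum_mono char_section_approx X_space \<omega>)
    also have "\<dots> = (\<bar>s\<bar> ^ 3 + s ^ 4) * level_sum X j g \<omega>"
      by (simp add: level_sum_def sum_distrib_left)
    finally have 1: "norm ((\<Prod>u\<in>generation j. \<phi> (X u \<omega>)) - (\<Prod>u\<in>generation j. e u)) \<le> \<dots>" .
    have prod_e: "(\<Prod>u\<in>generation j. e u) = complex_of_real (exp (- (s\<^sup>2 * level_sum X j (h l) \<omega> / 2)))"
      by (simp add: e_def level_sum_def sum_distrib_left sum_divide_distrib exp_sum flip: of_real_prod sum_negf)
    have "norm ((\<Prod>u\<in>generation j. e u) - complex_of_real c) =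
        \<bar>exp (- (s\<^sup>2 * level_sum X j (h l) \<omega> / 2)) - c\<bar>"
      unfolding prod_e by (simp only: norm_of_real flip: of_real_diff)
    also have "\<dots> \<le> \<bar>s\<^sup>2 * level_sum X j (h l) \<omega> / 2 - s\<^sup>2 * (2 ^ j * \<sigma> l) / 2\<bar>"
      unfolding c_def by (intro exp_minus_diff_le) (auto simp: level_sum_def h_nonneg \<sigma>_nonneg intro!: sum_nonneg mult_nonneg_nonneg)
    \<comment> \<open>Generation j has 2^j vertices, so centring each summand removes 2^j \<sigma> l
      in total.\<close>
    also have "\<dots> = s\<^sup>2 / 2 * \<bar>?D \<omega>\<bar>"
    proof -
      have "s\<^sup>2 * level_sum X j (h l) \<omega> / 2 - s\<^sup>2 * (2 ^ j * \<sigma> l) / 2 = s\<^sup>2 / 2 * ?D \<omega>"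
        by (simp add: level_sum_def sum_subtractf card_generation right_diff_distrib)
      then show ?thesis by (simp only: abs_mult) simp
    qed
    finally have 2: "norm ((\<Prod>u\<in>generation j. e u) - complex_of_real c) \<le> s\<^sup>2 / 2 * \<bar>?D \<omega>\<bar>" .
    show ?thesis
      using norm_triangle_le[OF add_mono[OF 1 2]] by simp
  qed
  have int_bd: "integrable \<Omega> (\<lambda>\<omega>. Z \<omega> * Y \<omega>)"
    if [measurable]: "Y \<in> borel_measurable \<Omega>" and "\<And>\<omega>. \<omega> \<in> space \<Omega> \<Longrightarrow> norm (Y \<omega>) \<le> 1" for Y
    by (rule integrable_const_bound[where B=1]) (use that in \<open>auto simp: norm_mult Z1\<close>)
  have prod1: "norm (\<Prod>u\<in>generation j. \<phi> (X u \<omega>)) \<le> 1" if "\<omega> \<in> space \<Omega>" for \<omega>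
    using \<phi>1[OF X_space[OF that]] by (simp add: prod_le_1 flip: prod_norm)
  have c1: "norm (complex_of_real c) \<le> 1"
    by (simp add: c_def \<sigma>_nonneg)
  have intE: "integrable \<Omega> (\<lambda>\<omega>. (\<bar>s\<bar> ^ 3 + s ^ 4) * level_sum X j g \<omega> + s\<^sup>2 / 2 * \<bar>?D \<omega>\<bar>)"
    using level_sum_integrable[OF g, of j] level_sum_integrable[OF F_diff[OF h_F F_const], of j l "\<sigma> l"] by simp
  have "norm (expectation (\<lambda>\<omega>. Z \<omega> * (\<Prod>u\<in>generation j. \<phi> (X u \<omega>))) - expectation Z * complex_of_real c) =
    norm (expectation (\<lambda>\<omega>. Z \<omega> * (\<Prod>u\<in>generation j. \<phi> (X u \<omega>)) - Z \<omega> * complex_of_real c))"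
    using int_bd[of "\<lambda>\<omega>. \<Prod>u\<in>generation j. \<phi> (X u \<omega>)"] prod1 int_bd[of "\<lambda>_. complex_of_real c"] c1
    by simp
  also have "\<dots> \<le> expectation (\<lambda>\<omega>. norm (Z \<omega> * (\<Prod>u\<in>generation j. \<phi> (X u \<omega>)) - Z \<omega> * complex_of_real c))"
    by (rule integral_norm_bound)
  also have "\<dots> \<le> expectation (\<lambda>\<omega>. (\<bar>s\<bar> ^ 3 + s ^ 4) * level_sum X j g \<omega> + s\<^sup>2 / 2 * \<bar>?D \<omega>\<bar>)"
  proof (rule integral_mono[OF _ intE])
    show "integrable \<Omega> (\<lambda>\<omega>. norm (Z \<omega> * (\<Prod>u\<in>generation j. \<phi> (X u \<omega>)) - Z \<omega> * complex_of_real c))"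
      using int_bd[of "\<lambda>\<omega>. \<Prod>u\<in>generation j. \<phi> (X u \<omega>)"] prod1 int_bd[of "\<lambda>_. complex_of_real c"] c1
      by (intro integrable_norm Bochner_Integration.integrable_diff) auto
    show "norm (Z \<omega> * (\<Prod>u\<in>generation j. \<phi> (X u \<omega>)) - Z \<omega> * complex_of_real c)
        \<le> (\<bar>s\<bar> ^ 3 + s ^ 4) * level_sum X j g \<omega> + s\<^sup>2 / 2 * \<bar>?D \<omega>\<bar>" if "\<omega> \<in> space \<Omega>" for \<omega>
      using point[OF that] by (simp add: norm_mult Z1 flip: right_diff_distrib)
  qed
  also have "\<dots> = (\<bar>s\<bar> ^ 3 + s ^ 4) * expectation (level_sum X j g) + s\<^sup>2 / 2 * expectation (\<lambda>\<omega>. \<bar>?D \<omega>\<bar>)"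
    using level_sum_integrable[OF g, of j] level_sum_integrable[OF F_diff[OF h_F F_const], of j l "\<sigma> l"] by simp
  finally show ?thesis
    unfolding step c_def Z_def[abs_def] l_def .
qed

text \<open>By induction over generations: the error made so far is multiplied by a deterministic
  factor of modulus at most 1, so the errors of the single steps add up.\<close>

lemma char_telescope:
  "norm (expectation (\<lambda>\<omega>. iexp (s * partial_sum n j \<omega>)) -
      complex_of_real (exp (- (\<Sum>k<j. s\<^sup>2 * (2 ^ k * \<sigma> (n - k)) / 2))))
    \<le> (\<Sum>k<j. (\<bar>s\<bar> ^ 3 + s ^ 4) * expectation (level_sum X k g) +
      s\<^sup>2 / 2 * expectation (\<lambda>\<omega>. \<bar>level_sum X k (\<lambda>x. h (n - k) x - \<sigma> (n - k)) \<omega>\<bar>))"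
proof (induction j)
  case 0
  then show ?case by (simp add: partial_sum_def prob_space)
next
  case (Suc j)
  let ?E = "\<lambda>j. expectation (\<lambda>\<omega>. iexp (s * partial_sum n j \<omega>))"
  let ?c = "\<lambda>k. s\<^sup>2 * (2 ^ k * \<sigma> (n - k)) / 2"
  have "norm (complex_of_real (exp (- ?c j))) \<le> 1" by (simp add: \<sigma>_nonneg)
  then have "norm ((?E j - complex_of_real (exp (- (\<Sum>k<j. ?c k)))) * complex_of_real (exp (- ?c j)))
      \<le> norm (?E j - complex_of_real (exp (- (\<Sum>k<j. ?c k))))"
    unfolding norm_mult by (rule mult_left_le) simp
  moreover have "(?E j - complex_of_real (exp (- (\<Sum>k<j. ?c k)))) * complex_of_real (exp (- ?c j)) =
      ?E j * complex_of_real (exp (- ?c j)) - complex_of_real (exp (- (\<Sum>k<Suc j. ?c k)))"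
    by (simp add: left_diff_distrib exp_diff exp_minus field_simps flip: of_real_mult exp_add)
  ultimately have "norm (?E j * complex_of_real (exp (- ?c j)) - complex_of_real (exp (- (\<Sum>k<Suc j. ?c k))))
    \<le> (\<Sum>k<j. (\<bar>s\<bar> ^ 3 + s ^ 4) * expectation (level_sum X k g) +
      s\<^sup>2 / 2 * expectation (\<lambda>\<omega>. \<bar>level_sum X k (\<lambda>x. h (n - k) x - \<sigma> (n - k)) \<omega>\<bar>))"
    using Suc.IH by simp
  from norm_triangle_le[OF add_mono[OF char_step[of s n j] this]] show ?case
    by (simp add: add.commute)
qed

section \<open>Limiting variance and convergence of characteristic functions\<close>

lemma summable_\<sigma>: "summable (\<lambda>l. (1 / 2) ^ l * \<sigma> l)"
proof (rule summable_comparison_test')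
  \<comment> \<open>The bound \<open>g\<close> is common to all l, so every \<sigma> l lies below
    one constant.\<close>
  show "summable (\<lambda>l. (1 / 2) ^ l * (\<integral>x. g x \<partial>\<mu>))"
    by (intro summable_mult2 summable_geometric) simp
  show "norm ((1 / 2) ^ l * \<sigma> l) \<le> (1 / 2) ^ l * (\<integral>x. g x \<partial>\<mu>)" for l
    using \<sigma>_nonneg \<sigma>_le by (simp add: abs_mult)
qed

text \<open>The substitution l = n - k turns 2^k / 2^n into 2^(-l).\<close>

lemma sum_rate_eq:
  "(\<Sum>k<Suc n. (t / sqrt (2 ^ n))\<^sup>2 * (2 ^ k * \<sigma> (n - k)) / 2) = t\<^sup>2 / 2 * (\<Sum>l<Suc n. (1 / 2) ^ l * \<sigma> l)"
  unfolding sum_distrib_left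
proof (rule sum.reindex_bij_witness[of _ "\<lambda>l. n - l" "\<lambda>k. n - k"])
  fix k assume "k \<in> {..<Suc n}"
  then obtain l where n: "n = k + l" using le_Suc_ex[of k n] by auto
  show "t\<^sup>2 / 2 * ((1 / 2) ^ (n - k) * \<sigma> (n - k)) = (t / sqrt (2 ^ n))\<^sup>2 * (2 ^ k * \<sigma> (n - k)) / 2"
    unfolding n by (simp add: power_divide power_add)
qed auto

text \<open>The centring constants vanish, because \<open>P f = 0\<close> on the state space, which
  carries \<mu>; the rest is the substitution k = n - l.\<close>

lemma N_root_eq:
  assumes "\<omega> \<in> space \<Omega>"
  shows "N_root P \<mu> X f n \<omega> = partial_sum n (Suc n) \<omega> / sqrt (2 ^ n)"
proof -
  have "(\<integral>x. kernel_op3 P (f l) x \<partial>\<mu>) = (\<integral>x. 0 \<partial>\<mu>)" for l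
    by (intro Bochner_Integration.integral_cong refl f_centred) (simp add: space_\<mu>)
  then have c: "centred P \<mu> (f l) t = f l t" for l t
    by (simp add: centred_def)
  have "(\<Sum>l\<le>n. tree_sum X (generation (n - l)) (centred P \<mu> (f l)) \<omega>) = partial_sum n (Suc n) \<omega>"
    unfolding tree_sum_def c partial_sum_def
    by (rule sum.reindex_bij_witness[of _ "\<lambda>l. n - l" "\<lambda>k. n - k"]) auto
  then show ?thesis by (simp add: N_root_def card_generation)
qed

lemma N_root_meas: "N_root P \<mu> X f n \<in> borel_measurable \<Omega>"
  by (subst measurable_cong[OF N_root_eq]) auto

text \<open>At s = t / 2^(n/2) the Taylor errors add up to order 2^n (|s|^3 + s^4) and the law of
  large numbers to order s^2 (2 \<rho>)^n = t^2 \<rho>^n. Both vanish, while the deterministic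
  exponents follow the partial sums of the variance series.\<close>

lemma char_N_root_tendsto:
  "(\<lambda>n. char (distr \<Omega> borel (N_root P \<mu> X f n)) t) \<longlonglongrightarrow>
    complex_of_real (exp (- (t\<^sup>2 * (\<Sum>l. (1 / 2) ^ l * \<sigma> l) / 2)))"
proof -
  obtain B where B: "0 \<le> B" and EB: "\<And>k. expectation (level_sum X k g) \<le> 2 ^ k * B"
    using expectation_level_sum_bounded[OF g] by blast
  obtain C \<rho> where C: "0 \<le> C" and \<rho>: "1 / 2 < \<rho>" "\<rho> < 1" and
    decay: "\<And>k u. u \<in> F \<Longrightarrow> (\<And>m x. x \<in> space S \<Longrightarrow> \<bar>(mean_child P ^^ m) u x\<bar> \<le> \<alpha> ^ m * g x) \<Longrightarrow>
      expectation (\<lambda>\<omega>. \<bar>level_sum X k u \<omega>\<bar>) \<le> C * (2 * \<rho>) ^ k"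
    using level_sum_decay[OF g] by blast
  define s where "s n = t / sqrt (2 ^ n)" for n
  define A where "A n = t\<^sup>2 / 2 * (\<Sum>l<Suc n. (1 / 2) ^ l * \<sigma> l)" for n
  \<comment> \<open>The telescoped error after summing the bounds over generations; 2 \<rho> - 1 > 0
    since \<rho> > 1/2.\<close>
  define R where "R n = (\<bar>s n\<bar> ^ 3 + s n ^ 4) * (2 ^ Suc n * B) +
    (s n)\<^sup>2 / 2 * (C * (2 * \<rho>) ^ Suc n / (2 * \<rho> - 1))" for n
  have char_eq: "char (distr \<Omega> borel (N_root P \<mu> X f n)) t = expectation (\<lambda>\<omega>. iexp (s n * partial_sum n (Suc n) \<omega>))" for n
  proof -
    have "char (distr \<Omega> borel (N_root P \<mu> X f n)) t = expectation (\<lambda>\<omega>. iexp (t * N_root P \<mu> X f n \<omega>))"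
      unfolding char_def by (rule integral_distr) (auto simp: N_root_meas)
    also have "\<dots> = expectation (\<lambda>\<omega>. iexp (s n * partial_sum n (Suc n) \<omega>))"
      by (intro Bochner_Integration.integral_cong refl) (simp add: N_root_eq s_def)
    finally show ?thesis .
  qed
  have bound: "norm (char (distr \<Omega> borel (N_root P \<mu> X f n)) t - complex_of_real (exp (- A n))) \<le> R n" for n
  proof -
    have "norm (char (distr \<Omega> borel (N_root P \<mu> X f n)) t - complex_of_real (exp (- A n))) \<le>
      (\<Sum>k<Suc n. (\<bar>s n\<bar> ^ 3 + s n ^ 4) * expectation (level_sum X k g) +
      (s n)\<^sup>2 / 2 * expectation (\<lambda>\<omega>. \<bar>level_sum X k (\<lambda>x. h (n - k) x - \<sigma> (n - k)) \<omega>\<bar>))"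
      using char_telescope[of "s n" n "Suc n"] unfolding char_eq A_def s_def sum_rate_eq .
    also have "\<dots> \<le> (\<Sum>k<Suc n. (\<bar>s n\<bar> ^ 3 + s n ^ 4) * (2 ^ k * B) + (s n)\<^sup>2 / 2 * (C * (2 * \<rho>) ^ k))"
      by (intro sum_mono add_mono mult_left_mono EB decay h_ergodic F_diff h_F F_const) auto
    also have "\<dots> = (\<bar>s n\<bar> ^ 3 + s n ^ 4) * ((\<Sum>k<Suc n. 2 ^ k) * B) +
        (s n)\<^sup>2 / 2 * (C * (\<Sum>k<Suc n. (2 * \<rho>) ^ k))"
      by (simp only: sum.distrib sum_distrib_left sum_distrib_right)
    also have "\<dots> \<le> R n"
      unfolding R_def
    proof (intro add_mono mult_left_mono mult_right_mono B)
      show "(\<Sum>k<Suc n. (2 :: real) ^ k) \<le> 2 ^ Suc n"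
        by (subst geometric_sum) auto
      have "(\<Sum>k<Suc n. (2 * \<rho>) ^ k) = ((2 * \<rho>) ^ Suc n - 1) / (2 * \<rho> - 1)"
        using \<rho> by (intro geometric_sum) auto
      also have "\<dots> \<le> (2 * \<rho>) ^ Suc n / (2 * \<rho> - 1)"
        using \<rho> by (intro divide_right_mono) auto
      finally show "C * (\<Sum>k<Suc n. (2 * \<rho>) ^ k) \<le> C * (2 * \<rho>) ^ Suc n / (2 * \<rho> - 1)"
        using mult_left_mono[OF _ C] by fastforce
    qed auto
    finally show ?thesis .
  qed
  \<comment> \<open>In this form \<open>R\<close> is a combination of three null geometric
    sequences, of ratios 1 / sqrt 2, 1/2 and \<rho>.\<close>
  have R_eq: "R n = 2 * B * \<bar>t\<bar> ^ 3 * (1 / sqrt 2) ^ n + 2 * B * t ^ 4 * (1 / 2) ^ n +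
      t\<^sup>2 * C * \<rho> / (2 * \<rho> - 1) * \<rho> ^ n" for n
  proof -
    have s2: "(s n)\<^sup>2 = t\<^sup>2 / 2 ^ n" by (simp add: s_def power_divide)
    have "sqrt 2 ^ n * sqrt 2 ^ n = 2 ^ n"
      by (simp flip: power_mult_distrib)
    then have "\<bar>s n\<bar> ^ 3 = \<bar>t\<bar> ^ 3 * (1 / sqrt 2) ^ n / 2 ^ n"
      by (simp add: s_def power_divide power3_eq_cube real_sqrt_power abs_divide)
    moreover have "s n ^ 4 = t ^ 4 * (1 / 2) ^ n / 2 ^ n"
      using arg_cong[OF s2, of "\<lambda>y. y\<^sup>2"] by (simp add: power_divide power2_eq_square power4_eq_xxxx mult.assoc)
    ultimately show ?thesis
      unfolding R_def s2 by (simp add: power_mult_distrib power_divide distrib_left distrib_right mult_ac)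
  qed
  have "R \<longlonglongrightarrow> 2 * B * \<bar>t\<bar> ^ 3 * 0 + 2 * B * t ^ 4 * 0 + t\<^sup>2 * C * \<rho> / (2 * \<rho> - 1) * 0"
    unfolding R_eq[abs_def] using \<rho>
    by (intro tendsto_add tendsto_mult tendsto_const LIMSEQ_power_zero) auto
  then have R0: "R \<longlonglongrightarrow> 0" by simp
  have "A \<longlonglongrightarrow> t\<^sup>2 / 2 * (\<Sum>l. (1 / 2) ^ l * \<sigma> l)"
    unfolding A_def[abs_def]
    by (intro tendsto_mult tendsto_const LIMSEQ_Suc summable_LIMSEQ summable_\<sigma>)
  then have lim: "(\<lambda>n. complex_of_real (exp (- A n))) \<longlonglongrightarrow>
      complex_of_real (exp (- (t\<^sup>2 / 2 * (\<Sum>l. (1 / 2) ^ l * \<sigma> l))))"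
    by (intro tendsto_of_real tendsto_exp tendsto_minus)
  have "(\<lambda>n. char (distr \<Omega> borel (N_root P \<mu> X f n)) t - complex_of_real (exp (- A n))) \<longlonglongrightarrow> 0"
    by (rule Lim_null_comparison[OF _ R0]) (use bound in simp)
  from tendsto_add[OF this lim] show ?thesis
    by simp
qed

end

section \<open>Convergence in distribution by Levy's continuity theorem\<close>

theorem theorem3p1:
  fixes \<Omega> :: "'w measure" and S :: "'s measure" and \<nu> \<mu> :: "'s measure"
    and P :: "'s \<Rightarrow> ('s \<times> 's) measure"
    and X :: "vertex \<Rightarrow> 'w \<Rightarrow> 's"
    and F :: "('s \<Rightarrow> real) set" and \<alpha> :: real
    and f :: "nat \<Rightarrow> 's \<times> 's \<times> 's \<Rightarrow> real"
  assumes "\<nu> \<in> space (prob_algebra S)"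
    and "P \<in> S \<rightarrow>\<^sub>M prob_algebra (S \<Otimes>\<^sub>M S)"
    and "bifurcating_markov_chain \<Omega> S \<nu> P X"
    and "structural_assumption S \<nu> P F"
    and "geometric_ergodicity S (induced_kernel S P) F \<mu> \<alpha>"
    and "\<And>l. f l \<in> borel_measurable (S \<Otimes>\<^sub>M S \<Otimes>\<^sub>M S)"
    and "\<And>l. well_defined3 S P (f l)"
    and "\<And>l. well_defined3 S P (\<lambda>t. f l t ^ 2)"
    and "\<And>l. well_defined3 S P (\<lambda>t. f l t ^ 4)"
    and "\<exists>g\<in>F.
      uniform_ergodic_bounds S (induced_kernel S P) F \<mu> \<alpha> (\<lambda>l. kernel_op3 P (f l)) g \<and>
      uniform_ergodic_bounds S (induced_kernel S P) F \<mu> \<alpha> (\<lambda>l. kernel_op3 P (\<lambda>t. f l t ^ 2)) g \<and>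
      uniform_ergodic_bounds S (induced_kernel S P) F \<mu> \<alpha> (\<lambda>l. kernel_op3 P (\<lambda>t. f l t ^ 4)) g"
    and "\<And>l x. x \<in> space S \<Longrightarrow> kernel_op3 P (f l) x = 0"
  shows "summable (\<lambda>l. (1 / 2) ^ l * (\<integral>x. kernel_op3 P (\<lambda>t. f l t ^ 2) x \<partial>\<mu>)) \<and>
    weak_conv_m (\<lambda>n. distr \<Omega> borel (N_root P \<mu> X f n))
      (gaussian_law 0 (\<Sum>l. (1 / 2) ^ l * (\<integral>x. kernel_op3 P (\<lambda>t. f l t ^ 2) x \<partial>\<mu>)))"
proof -
  obtain g where g: "g \<in> F"
    "uniform_ergodic_bounds S (induced_kernel S P) F \<mu> \<alpha> (\<lambda>l. kernel_op3 P (\<lambda>t. f l t ^ 2)) g"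
    "uniform_ergodic_bounds S (induced_kernel S P) F \<mu> \<alpha> (\<lambda>l. kernel_op3 P (\<lambda>t. f l t ^ 4)) g"
    using assms(10) by blast
  interpret centred_functional \<Omega> S \<nu> \<mu> P X F \<alpha> f g
    by unfold_locales (fact assms g)+
  let ?\<Sigma> = "\<Sum>l. (1 / 2) ^ l * \<sigma> l"
  \<comment> \<open>Nonnegativity of the variance makes \<open>gaussian_law\<close> a probability
    law, a point mass in the degenerate case.\<close>
  have \<Sigma>: "0 \<le> ?\<Sigma>"
    by (intro suminf_nonneg summable_\<sigma>) (simp add: \<sigma>_nonneg)
  have "weak_conv_m (\<lambda>n. distr \<Omega> borel (N_root P \<mu> X f n)) (gaussian_law 0 ?\<Sigma>)"
  proof (rule levy_continuity)
    show "real_distribution (distr \<Omega> borel (N_root P \<mu> X f n))" for n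
      by (rule real_distribution_distr) (rule N_root_meas)
    show "real_distribution (gaussian_law 0 ?\<Sigma>)"
      by (rule real_distribution_gaussian_law[OF \<Sigma>])
    show "(\<lambda>n. char (distr \<Omega> borel (N_root P \<mu> X f n)) t) \<longlonglongrightarrow> char (gaussian_law 0 ?\<Sigma>) t" for t
      unfolding char_gaussian_law[OF \<Sigma>] by (rule char_N_root_tendsto)
  qed
  \<comment> \<open>Summability accompanies the limit, because the infinite sum in the variance is
    meaningful only together with it.\<close>
  then show ?thesis
    using summable_\<sigma> by (simp add: \<sigma>_def h_def)
qed

end
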